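(* Let $\rho$ be a primitive $k$th root of unity, $L\in\mathbb Z_{\ge1}$, $\delta>0$, $C>0$. For all integers $N\ge1$ with $k\mid N$ and all $z$ with $\mathrm{Re}(z)\le-\delta$, $|z|\le C$, $$\frac{1}{(\rho e^{z/N})_N}=\Big(\frac kN\Big)^{1/2}g_\rho(z)\exp\Big(\frac Nk\,p(kz)+\sum_{\ell=1}^{L-1}\frac{f_{\rho,\ell}(z)}{N^{\ell}}+O(N^{-L})\Big),$$ with implied constant depending only on $L,k,\delta,C$.
   Context: $(q)_N:=(1-q)(1-q^2)\cdots(1-q^N)$ (so $(\rho e^{z/N})_N=\prod_{j=1}^N(1-\rho^je^{jz/N})$). Polylogarithms: $\mathrm{Li}_2(w)=\sum w^n/n^2$ ($|w|\le1$); $\mathrm{Li}_1(w)=-\log(1-w)$ (principal); for integer $s\le0$ and $w\ne1$, $\mathrm{Li}_s(w)$ is the rational function $(w\frac{d}{dw})^{-s}\big(\frac{w}{1-w}\big)$, equal to $\sum n^{-s}w^n$ for $|w|<1$. $p(z):=(\mathrm{Li}_2(e^z)-\mathrm{Li}_2(1))/z$. Bernoulli polynomials: $ze^{\lambda z}/(e^z-1)=\sum B_n(\lambda)z^n/n!$, $B_n=B_n(0)$. Define (all powers principal) $g_\rho(z):=\Big(\frac{-z}{2\pi(1-e^z)}\Big)^{1/2}\prod_{j=1}^{k-1}\Big(\frac{1-\rho^{-j}e^z}{1-\rho^{-j}}\Big)^{j/k-1/2}$ and, for $\ell\ge1$, $f_{\rho,\ell}(z):=\frac{(-1)^{\ell+1}(kz)^\ell}{(\ell+1)!}\Big(\delta_{1,\ell}\frac1{12}+B_{\ell+1}\mathrm{Li}_{1-\ell}(e^z)+\sum_{j=1}^{k-1}B_{\ell+1}(j/k)\big\{\mathrm{Li}_{1-\ell}(\rho^{-j}e^z)-\mathrm{Li}_{1-\ell}(\rho^{-j})\big\}\Big)$.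 *)

theory Defs
  imports "HOL-Analysis.Analysis" "HOL-Computational_Algebra.Formal_Power_Series"
begin

text \<open>Dilogarithm Li_2(w) = sum_{n>=1} w^n/n^2 (meant for norm w \<le> 1).\<close>
definition Li2 :: "complex \<Rightarrow> complex" where
  "Li2 w = (\<Sum>n. w ^ Suc n / (of_nat (Suc n))\<^sup>2)"

text \<open>Li_{-m}(w) for m :: nat, w \<noteq> 1: the rational function (w d/dw)^m (w/(1-w)).\<close>
fun polylog_neg :: "nat \<Rightarrow> complex \<Rightarrow> complex" where
  "polylog_neg 0 w = w / (1 - w)"
| "polylog_neg (Suc m) w = w * deriv (polylog_neg m) w"

definition bernpoly :: "nat \<Rightarrow> complex \<Rightarrow> complex" where
  "bernpoly n x = fact n * fps_nth ((fps_X * fps_exp x) div (fps_exp 1 - 1)) n"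

text \<open>q-Pochhammer symbol (q)_N = prod_{j=1}^N (1 - q^j), written for q = rho e^{z/N}.\<close>
definition qpoch_rho :: "complex \<Rightarrow> complex \<Rightarrow> nat \<Rightarrow> complex" where
  "qpoch_rho \<rho> z N = (\<Prod>j=1..N. 1 - \<rho> ^ j * exp (of_nat j * z / of_nat N))"

definition pfun :: "complex \<Rightarrow> complex" where
  "pfun z = (Li2 (exp z) - Li2 1) / z"

definition gfun :: "nat \<Rightarrow> complex \<Rightarrow> complex \<Rightarrow> complex" where
  "gfun k \<rho> z = (- z / (2 * of_real pi * (1 - exp z))) powr (1/2)
     * (\<Prod>j=1..k-1. ((1 - inverse \<rho> ^ j * exp z) / (1 - inverse \<rho> ^ j))
                      powr (of_nat j / of_nat k - 1/2))"

definition ffun :: "nat \<Rightarrow> complex \<Rightarrow> nat \<Rightarrow> complex \<Rightarrow> complex" where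
  "ffun k \<rho> l z = (-1) ^ (l + 1) * (of_nat k * z) ^ l / fact (l + 1)
     * ((if l = 1 then 1/12 else 0)
        + bernpoly (l + 1) 0 * polylog_neg (l - 1) (exp z)
        + (\<Sum>j=1..k-1. bernpoly (l + 1) (of_nat j / of_nat k)
             * (polylog_neg (l - 1) (inverse \<rho> ^ j * exp z) - polylog_neg (l - 1) (inverse \<rho> ^ j))))"

end

theory Submission
  imports Defs "HOL-Complex_Analysis.Complex_Analysis" "HOL-Real_Asymp.Real_Asymp"
begin

text \<open>
  Write $N = kM$ and split the product over $j$ into residue classes $j = km + r$ with
  $1 \le r \le k$. With $\varepsilon = z/M$ the logarithm of the $r$-th class is
  $\sum_{m<M} h_r((m + r/k)\varepsilon)$ for $h_r(u) = \log(1 - \rho^r e^u)$, to which the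
  Euler--Maclaurin formula with Bernoulli polynomials at $r/k$ and complex step $\varepsilon$
  applies. All points lie in a compact convex wedge that touches the imaginary axis only at $0$,
  which makes the bounds uniform in $z$.

  For $r < k$ the function $h_r$ is holomorphic around the wedge and has the primitive
  $-\mathrm{Li}_2(\rho^r e^u)$. For $r = k$ it has a logarithmic singularity at $0$; there
  $\log(1 - e^u) = \log(-u) + \log((e^u - 1)/u)$, where the first summand contributes $\log M!$,
  expanded by Stirling's series, and the second one is regular.
  Finally $\sum_r \mathrm{Li}_2(\rho^r w) = \mathrm{Li}_2(w^k)/k$ collects the main terms, and
  $B_n(1 - x) = (-1)^n B_n(x)$ turns $\rho^r$ into $\rho^{-j}$ with $j = k - r$.
\<close>

section \<open>Bernoulli polynomials\<close>

text \<open>The shape of the proof is dictated by the class r = k: there log(1 - e^u) and its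
  derivatives blow up at the apex u = 0, so no boundary terms can be taken there. Subtracting
  log(-u) repairs this, and its cost cancels: the poles that log(-u) leaves in the derivatives at z
  are exactly the correction terms of Stirling's series. Hence \<open>ffun\<close> contains
  Li_{1-l}(e^z) with no value subtracted at the apex, and the factor 2 pi of Stirling's formula sits
  in \<open>gfun\<close>. The derivatives of log((e^u - 1)/u) at 0 survive only for l = 1: those of
  odd order at least 3 vanish, and those of even order at least 2 are multiplied by a vanishing
  B_n(1). What remains is B_2(1) * 1/2 = 1/12. Branches are harmless for one reason: on the wedge, 1
  - w e^u with |w| = 1 has positive real part wherever it is nonzero, so principal logarithms of the
  quotients split without multiples of 2 pi i. Only finitely many \<rho> occur for a given k, so a
  bound for each \<rho> separately suffices.\<close>

definition bernoulli_fps :: "complex \<Rightarrow> complex fps" where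
  "bernoulli_fps x = (fps_X * fps_exp x) div (fps_exp 1 - 1)"

lemma bernpoly_eq_fps_nth: "bernpoly n x = fact n * fps_nth (bernoulli_fps x) n"
  by (simp add: bernpoly_def bernoulli_fps_def)

lemma fps_exp_minus_1_nonzero: "fps_exp 1 - 1 \<noteq> (0 :: complex fps)"
  by simp

text \<open>The operation \<open>div\<close> is a true quotient only under divisibility, which holds
  because both series have subdegree 1. The facts about \<open>bernpoly\<close> below rest on this
  product form, by comparing coefficients or cancelling e^X - 1.\<close>

lemma bernoulli_fps_mult: "bernoulli_fps x * (fps_exp 1 - 1) = fps_X * fps_exp x"
proof -
  have "subdegree (fps_exp 1 - 1 :: complex fps) = 1"
    by (rule subdegreeI) auto
  moreover have "subdegree (fps_X * fps_exp x) = 1"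
    by (rule subdegreeI) auto
  ultimately have "(fps_exp 1 - 1) dvd fps_X * fps_exp x"
    by (subst fps_dvd_iff) auto
  then show ?thesis
    unfolding bernoulli_fps_def by simp
qed

text \<open>Coefficient of X^s in the product identity; the term n = s is absent because e^X - 1 has
  no constant term. This is the form in which Taylor coefficients of equal total order regroup in
  \<open>euler_maclaurin_step\<close>.\<close>

lemma bernpoly_convolution:
  assumes "s \<ge> 1"
  shows "(\<Sum>n<s. bernpoly n x / (fact n * fact (s - n))) = x ^ (s - 1) / fact (s - 1)"
proof -
  have "(\<Sum>n<s. bernpoly n x / (fact n * fact (s - n)))
      = (\<Sum>n\<le>s. fps_nth (bernoulli_fps x) n * fps_nth (fps_exp 1 - 1) (s - n))"
    by (rule sum.mono_neutral_cong_left) (auto simp: bernpoly_eq_fps_nth)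
  also have "\<dots> = fps_nth (bernoulli_fps x * (fps_exp 1 - 1)) s"
    by (simp add: fps_mult_nth atLeast0AtMost)
  also have "\<dots> = x ^ (s - 1) / fact (s - 1)"
    using assms by (simp add: bernoulli_fps_mult)
  finally show ?thesis .
qed

lemma bernpoly_0: "bernpoly 0 x = 1"
  using bernpoly_convolution[of 1 x] by simp

lemma bernpoly_1: "bernpoly 1 x = x - 1/2"
  using bernpoly_convolution[of 2 x]
  by (simp add: numeral_2_eq_2 bernpoly_0 algebra_simps)

lemma bernpoly_2_1: "bernpoly 2 1 = 1/6"
proof -
  have "bernpoly (Suc 0) 1 = 1/2"
    using bernpoly_1[of 1] by simp
  then have "1/6 + 1/4 + bernpoly 2 1 / 2 = 1/2"
    using bernpoly_convolution[of 3 1]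
    by (simp add: numeral_3_eq_3 numeral_2_eq_2 bernpoly_0)
  then show ?thesis
    by (simp add: field_simps)
qed

text \<open>Replacing X by -X in the product identity and multiplying by e^X turns the generating
  function at x into the one at 1 - x. It later exchanges the residue classes r and k - r.\<close>

lemma bernpoly_reflect: "bernpoly n (1 - x) = (-1) ^ n * bernpoly n x"
proof -
  have "(bernoulli_fps x * (fps_exp 1 - 1)) oo (-fps_X) = (fps_X * fps_exp x) oo (-fps_X)"
    by (simp add: bernoulli_fps_mult)
  then have "(bernoulli_fps x oo (-fps_X)) * (fps_exp (-1) - 1) = - fps_X * fps_exp (-x)"
    by (simp add: fps_compose_mult_distrib fps_compose_sub_distrib)
  from arg_cong[OF this, of "\<lambda>t. t * fps_exp 1"]
  have "(bernoulli_fps x oo (-fps_X)) * ((fps_exp (-1) - 1) * fps_exp 1)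
      = - (fps_X * (fps_exp (-x) * fps_exp 1))"
    by (simp only: mult.assoc mult_minus_left)
  moreover have "(fps_exp (-1) - 1) * fps_exp 1 = - (fps_exp 1 - 1 :: complex fps)"
    using fps_exp_add_mult[of "-1" "1::complex"] by (simp add: algebra_simps)
  moreover have "fps_exp (-x) * fps_exp 1 = fps_exp (1 - x)"
    using fps_exp_add_mult[of "-x" 1] by simp
  ultimately have "(bernoulli_fps x oo (-fps_X)) * (fps_exp 1 - 1) = fps_X * fps_exp (1 - x)"
    by (simp only: mult_minus_right neg_equal_iff_equal)
  also have "\<dots> = bernoulli_fps (1 - x) * (fps_exp 1 - 1)"
    by (simp add: bernoulli_fps_mult)
  finally have "bernoulli_fps (1 - x) = bernoulli_fps x oo (-fps_X)"
    using fps_exp_minus_1_nonzero by (metis mult_right_cancel)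
  also have "- fps_X = fps_const (-1) * (fps_X :: complex fps)"
    by (simp flip: fps_const_neg)
  finally show ?thesis
    by (simp add: bernpoly_eq_fps_nth fps_compose_linear)
qed

text \<open>The generating functions at 1 and at 0 differ by exactly X, so only the coefficient of
  order 1 changes.\<close>

lemma bernpoly_1_eq_0:
  assumes "n \<noteq> 1"
  shows "bernpoly n 1 = bernpoly n 0"
proof -
  have "(bernoulli_fps 1 - bernoulli_fps 0) * (fps_exp 1 - 1) = fps_X * (fps_exp 1 - 1)"
    by (simp add: left_diff_distrib bernoulli_fps_mult) (simp add: algebra_simps)
  then have "bernoulli_fps 1 - bernoulli_fps 0 = fps_X"
    using fps_exp_minus_1_nonzero by (metis mult_right_cancel)
  then have "fps_nth (bernoulli_fps 1 - bernoulli_fps 0) n = fps_nth fps_X n"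
    by simp
  with assms show ?thesis
    by (simp add: bernpoly_eq_fps_nth)
qed

lemma bernpoly_1_odd:
  assumes "odd n" "n \<noteq> 1"
  shows "bernpoly n 1 = 0"
  using bernpoly_reflect[of n 0] bernpoly_1_eq_0[of n] assms by (simp)

section \<open>The Euler--Maclaurin formula\<close>

text \<open>The 1 pays for the Taylor remainder of \<open>f 1\<close> at the sampled point, each
  |B_n(x)| for the remainder of \<open>f n\<close>; the factorials in the denominators are simply
  bounded below by 1.\<close>

definition em_const :: "nat \<Rightarrow> complex \<Rightarrow> real" where
  "em_const P x = 1 + (\<Sum>n<P. norm (bernpoly n x))"

lemma em_const_pos: "em_const P x > 0"
  unfolding em_const_def by (smt (verit) norm_ge_zero sum_nonneg)

text \<open>
  Expanding every $f_n$ at $a$ by Taylor's theorem, the terms up to order $P$ agree exactly: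
  this is the convolution identity for the Bernoulli polynomials. No integral is needed, since the
  primitive $f_0$ of the summand takes its place.
\<close>
lemma euler_maclaurin_step:
  fixes f :: "nat \<Rightarrow> complex \<Rightarrow> complex" and x :: real
  assumes S: "convex S"
    and f: "\<And>i u. u \<in> S \<Longrightarrow> i \<le> P \<Longrightarrow> (f i has_field_derivative f (Suc i) u) (at u within S)"
    and B: "\<And>u. u \<in> S \<Longrightarrow> norm (f (Suc P) u) \<le> B"
    and a: "a \<in> S" and a': "a + \<epsilon> \<in> S"
    and x: "0 \<le> x" "x \<le> 1" and P: "P \<ge> 1"
  shows "norm (\<epsilon> * f 1 (a + of_real x * \<epsilon>)
           - (\<Sum>n<P. bernpoly n x / fact n * \<epsilon> ^ n * (f n (a + \<epsilon>) - f n a)))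
         \<le> em_const P x * B * norm \<epsilon> ^ (P + 1)"
proof -
  have B0: "B \<ge> 0"
    using B[OF a] norm_ge_zero order_trans by blast
  \<comment> \<open>Taylor expansion of \<open>f n\<close> stops at order P - n, so that
    \<epsilon>^n \<open>T n\<close> is of size |\<epsilon>|^(P+1) for every n.\<close>
  define T where "T n = f n (a + \<epsilon>) - (\<Sum>i\<le>P - n. f (n + i) a * \<epsilon> ^ i / fact i)" for n
  have T: "norm (T n) \<le> B * norm \<epsilon> ^ (P - n + 1)" if "n < P" for n
  proof -
    have "norm (f (n + 0) (a + \<epsilon>) - (\<Sum>i\<le>P - n. f (n + i) a * (a + \<epsilon> - a) ^ i / fact i))
        \<le> B * norm (a + \<epsilon> - a) ^ Suc (P - n) / fact (P - n)"
      by (rule complex_Taylor[OF S, where f = "\<lambda>i. f (n + i)"]) (use that f B a a' in auto)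
    also have "\<dots> \<le> B * norm (a + \<epsilon> - a) ^ Suc (P - n) / 1"
      by (intro divide_left_mono mult_nonneg_nonneg B0) (auto simp: fact_ge_1)
    finally show ?thesis by (simp add: T_def)
  qed
  define R where "R = f 1 (a + of_real x * \<epsilon>) - (\<Sum>i<P. f (1 + i) a * (of_real x * \<epsilon>) ^ i / fact i)"
  have ax: "a + of_real x * \<epsilon> \<in> S"
  proof -
    have "(1 - x) *\<^sub>R a + x *\<^sub>R (a + \<epsilon>) \<in> S"
      using S a a' x by (intro convexD) auto
    then show ?thesis by (simp add: scaleR_conv_of_real algebra_simps)
  qed
  have R: "norm R \<le> B * norm \<epsilon> ^ P"
  proof -
    have P': "{..<P} = {..P - 1}" using P by auto
    have "norm (f (1 + 0) (a + of_real x * \<epsilon>) - (\<Sum>i\<le>P - 1. f (1 + i) a * (a + of_real x * \<epsilon> - a) ^ i / fact i))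
        \<le> B * norm (a + of_real x * \<epsilon> - a) ^ Suc (P - 1) / fact (P - 1)"
      by (rule complex_Taylor[OF S, where f = "\<lambda>i. f (1 + i)"]) (use P f B a ax in auto)
    also have "\<dots> \<le> B * norm (a + of_real x * \<epsilon> - a) ^ Suc (P - 1) / 1"
      by (intro divide_left_mono mult_nonneg_nonneg B0) (auto simp: fact_ge_1)
    also have "\<dots> = B * (x * norm \<epsilon>) ^ P"
      using P x by (simp add: norm_mult)
    also have "\<dots> \<le> B * norm \<epsilon> ^ P"
      using x B0 by (intro mult_left_mono power_mono mult_left_le_one_le) auto
    finally show ?thesis by (simp add: R_def P')
  qed
  \<comment> \<open>Collecting by total order s = n + i leaves the convolution sum as the
    coefficient of \<epsilon>^s f_s(a). The index i starts at 1 because the difference of the two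
    values of \<open>f n\<close> removes the constant Taylor term.\<close>
  have main: "\<epsilon> * (\<Sum>i<P. f (1 + i) a * (of_real x * \<epsilon>) ^ i / fact i)
     = (\<Sum>n<P. bernpoly n x / fact n * \<epsilon> ^ n * (\<Sum>i\<in>{1..P - n}. f (n + i) a * \<epsilon> ^ i / fact i))"
  proof -
    have "(\<Sum>n<P. bernpoly n x / fact n * \<epsilon> ^ n * (\<Sum>i\<in>{1..P - n}. f (n + i) a * \<epsilon> ^ i / fact i))
       = (\<Sum>(n, i)\<in>Sigma {..<P} (\<lambda>n. {1..P - n}). bernpoly n x / (fact n * fact i) * \<epsilon> ^ (n + i) * f (n + i) a)"
      by (subst sum.Sigma [symmetric]) (auto simp: sum_distrib_left power_add field_simps intro!: sum.cong)
    also have "\<dots> = (\<Sum>(s, n)\<in>Sigma {1..P} (\<lambda>s. {..<s}). bernpoly n x / (fact n * fact (s - n)) * \<epsilon> ^ s * f s a)"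
      by (rule sum.reindex_bij_witness[where i = "\<lambda>(s, n). (n, s - n)" and j = "\<lambda>(n, i). (n + i, n)"]) auto
    also have "\<dots> = (\<Sum>s\<in>{1..P}. (\<Sum>n<s. bernpoly n x / (fact n * fact (s - n))) * \<epsilon> ^ s * f s a)"
      by (subst sum.Sigma [symmetric]) (auto simp: sum_distrib_right)
    also have "\<dots> = (\<Sum>s\<in>{1..P}. of_real x ^ (s - 1) / fact (s - 1) * \<epsilon> ^ s * f s a)"
      by (intro sum.cong refl) (simp add: bernpoly_convolution)
    also have "\<dots> = (\<Sum>i<P. \<epsilon> * (f (1 + i) a * (of_real x * \<epsilon>) ^ i / fact i))"
      by (simp add: sum.atLeast1_atMost_eq power_mult_distrib mult_ac)
    finally show ?thesis by (simp add: sum_distrib_left)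
  qed
  have split: "f n (a + \<epsilon>) - f n a = T n + (\<Sum>i\<in>{1..P - n}. f (n + i) a * \<epsilon> ^ i / fact i)" for n
  proof -
    have "{..P - n} = insert 0 {1..P - n}" by auto
    then show ?thesis by (simp add: T_def)
  qed
  have "\<epsilon> * f 1 (a + of_real x * \<epsilon>)
           - (\<Sum>n<P. bernpoly n x / fact n * \<epsilon> ^ n * (f n (a + \<epsilon>) - f n a))
      = \<epsilon> * R - (\<Sum>n<P. bernpoly n x / fact n * \<epsilon> ^ n * T n)"
    unfolding split distrib_left sum.distrib main[symmetric] R_def right_diff_distrib by simp
  also have "norm \<dots> \<le> norm (\<epsilon> * R) + (\<Sum>n<P. norm (bernpoly n x / fact n * \<epsilon> ^ n * T n))"
    by (rule order_trans[OF norm_triangle_ineq4 add_left_mono[OF norm_sum]])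
  also have "norm (\<epsilon> * R) \<le> B * norm \<epsilon> ^ (P + 1)"
    using R mult_left_mono[OF R norm_ge_zero[of \<epsilon>]] by (simp add: norm_mult mult_ac)
  also have "(\<Sum>n<P. norm (bernpoly n x / fact n * \<epsilon> ^ n * T n))
     \<le> (\<Sum>n<P. norm (bernpoly n x) * (B * norm \<epsilon> ^ (P + 1)))"
  proof (rule sum_mono)
    fix n assume n: "n \<in> {..<P}"
    have "norm (bernpoly n x / fact n * \<epsilon> ^ n * T n) = norm (bernpoly n x) / fact n * (norm \<epsilon> ^ n * norm (T n))"
      by (simp add: norm_mult norm_divide norm_power)
    also have "\<dots> \<le> norm (bernpoly n x) / 1 * (norm \<epsilon> ^ n * (B * norm \<epsilon> ^ (P - n + 1)))"
      using n by (intro mult_mono divide_left_mono mult_left_mono T) (auto simp: fact_ge_1)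
    also have "norm \<epsilon> ^ n * (B * norm \<epsilon> ^ (P - n + 1)) = B * norm \<epsilon> ^ (P + 1)"
      using n by (simp add: power_add [symmetric] mult_ac flip: power_Suc)
    finally show "norm (bernpoly n x / fact n * \<epsilon> ^ n * T n) \<le> norm (bernpoly n x) * (B * norm \<epsilon> ^ (P + 1))"
      by simp
  qed
  finally show ?thesis
    by (simp add: em_const_def distrib_right sum_distrib_right mult.assoc)
qed

text \<open>The one-step estimate is summed along the segment from 0 to z, which stays in S by
  convexity, and the boundary terms telescope. Uniformity in z comes from compactness: the constant
  involves only bounds for a derivative of h and for |u| over S.\<close>

lemma euler_maclaurin_holomorphic:
  fixes h G :: "complex \<Rightarrow> complex" and x :: real
  assumes h: "h holomorphic_on U" "open U" and S: "S \<subseteq> U" "convex S" "compact S" "0 \<in> S"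
    and G: "\<And>u. u \<in> S \<Longrightarrow> (G has_field_derivative h u) (at u within S)"
    and x: "0 \<le> x" "x \<le> 1"
  shows "\<exists>K. \<forall>z\<in>S. \<forall>M\<ge>1. z \<noteq> 0 \<longrightarrow>
    norm ((\<Sum>m<M. h ((of_nat m + of_real x) * (z / of_nat M)))
       - (of_nat M / z * (G z - G 0)
          + (\<Sum>n=1..L. bernpoly n (of_real x) / fact n * (z / of_nat M) ^ (n - 1)
              * ((deriv ^^ (n - 1)) h z - (deriv ^^ (n - 1)) h 0))))
    \<le> K / real M ^ L"
proof -
  \<comment> \<open>Shifting the derivatives by one puts the primitive at index 0, so the main term
    is the summand n = 0 of the same telescoping sum.\<close>
  define f where "f i = (case i of 0 \<Rightarrow> G | Suc j \<Rightarrow> (deriv ^^ j) h)" for i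
  have f_deriv: "(f i has_field_derivative f (Suc i) u) (at u within S)" if "u \<in> S" for i u
  proof (cases i)
    case 0
    then show ?thesis using G that by (simp add: f_def)
  next
    case (Suc j)
    have "((deriv ^^ j) h has_field_derivative (deriv ^^ (Suc j)) h u) (at u)"
      using that S by (intro has_field_derivative_higher_deriv[OF h]) auto
    then show ?thesis
      using Suc by (simp add: f_def has_field_derivative_at_within)
  qed
  \<comment> \<open>Each step errs by |\<epsilon>|^(P+1); adding M of them and dividing by
    \<epsilon> leaves M |z/M|^P, which is of order M^(-L) for P = L + 1.\<close>
  define P where "P = L + 1"
  have "continuous_on S (f (Suc P))"
    using h S unfolding f_def P_def
    by (auto intro!: holomorphic_on_imp_continuous_on intro: holomorphic_on_subset holomorphic_higher_deriv
        simp del: funpow.simps)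
  then have "compact (f (Suc P) ` S)"
    using S by (intro compact_continuous_image)
  then obtain B where B: "\<And>u. u \<in> S \<Longrightarrow> norm (f (Suc P) u) \<le> B"
    by (meson bounded_iff compact_imp_bounded imageI)
  have B0: "B \<ge> 0"
    using B[OF S(4)] norm_ge_zero order_trans by blast
  obtain R where R: "\<And>u. u \<in> S \<Longrightarrow> norm u \<le> R"
    by (meson S(3) bounded_iff compact_imp_bounded)
  show ?thesis
  proof (intro exI ballI allI impI)
    fix z M assume z: "z \<in> S" "z \<noteq> 0" and M: "M \<ge> (1::nat)"
    define \<epsilon> where "\<epsilon> = z / of_nat M"
    have \<epsilon>: "\<epsilon> \<noteq> 0" using z M by (simp add: \<epsilon>_def)
    have pts: "of_nat m * \<epsilon> \<in> S" if "m \<le> M" for m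
    proof -
      have "(1 - m / M) *\<^sub>R 0 + (m / M) *\<^sub>R z \<in> S"
        using S z M that by (intro convexD) (auto simp: field_simps)
      then show ?thesis by (simp add: scaleR_conv_of_real \<epsilon>_def)
    qed
    define b where "b n = bernpoly n (of_real x) / fact n" for n
    define H where "H = (\<Sum>m<M. h ((of_nat m + of_real x) * \<epsilon>))"
    have step: "norm (\<epsilon> * h ((of_nat m + of_real x) * \<epsilon>)
         - (\<Sum>n<P. b n * \<epsilon> ^ n * (f n (of_nat (Suc m) * \<epsilon>) - f n (of_nat m * \<epsilon>))))
        \<le> em_const P x * B * norm \<epsilon> ^ (P + 1)" if "m < M" for m
    proof -
      have "norm (\<epsilon> * f 1 (of_nat m * \<epsilon> + of_real x * \<epsilon>)
         - (\<Sum>n<P. bernpoly n (of_real x) / fact n * \<epsilon> ^ n * (f n (of_nat m * \<epsilon> + \<epsilon>) - f n (of_nat m * \<epsilon>))))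
        \<le> em_const P x * B * norm \<epsilon> ^ (P + 1)"
        by (rule euler_maclaurin_step[OF S(2) f_deriv B])
          (use x that pts[of m] pts[of "Suc m"] in \<open>auto simp: P_def algebra_simps\<close>)
      then show ?thesis
        by (simp add: b_def f_def algebra_simps)
    qed
    have "\<epsilon> * H - (\<Sum>n<P. b n * \<epsilon> ^ n * (f n z - f n 0))
        = (\<Sum>m<M. \<epsilon> * h ((of_nat m + of_real x) * \<epsilon>)
         - (\<Sum>n<P. b n * \<epsilon> ^ n * (f n (of_nat (Suc m) * \<epsilon>) - f n (of_nat m * \<epsilon>))))"
    proof -
      have "f n z - f n 0 = (\<Sum>m<M. f n (of_nat (Suc m) * \<epsilon>) - f n (of_nat m * \<epsilon>))" for n
        using sum_lessThan_telescope[of "\<lambda>m. f n (of_nat m * \<epsilon>)" M] M by (simp add: \<epsilon>_def)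
      then have "(\<Sum>n<P. b n * \<epsilon> ^ n * (f n z - f n 0))
         = (\<Sum>n<P. \<Sum>m<M. b n * \<epsilon> ^ n * (f n (of_nat (Suc m) * \<epsilon>) - f n (of_nat m * \<epsilon>)))"
        by (simp only: sum_distrib_left)
      also have "\<dots> = (\<Sum>m<M. \<Sum>n<P. b n * \<epsilon> ^ n * (f n (of_nat (Suc m) * \<epsilon>) - f n (of_nat m * \<epsilon>)))"
        by (rule sum.swap)
      finally show ?thesis
        by (simp only: H_def sum_subtractf sum_distrib_left)
    qed
    also have "norm \<dots> \<le> (\<Sum>m<M. em_const P x * B * norm \<epsilon> ^ (P + 1))"
      by (rule order_trans[OF norm_sum sum_mono]) (use step in auto)
    finally have "norm (\<epsilon> * H - (\<Sum>n<P. b n * \<epsilon> ^ n * (f n z - f n 0)))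
       \<le> real M * (em_const P x * B * norm \<epsilon> ^ (P + 1))" by simp
    moreover have "\<epsilon> * H - (\<Sum>n<P. b n * \<epsilon> ^ n * (f n z - f n 0))
       = \<epsilon> * (H - (of_nat M / z * (G z - G 0)
          + (\<Sum>n=1..L. b n * \<epsilon> ^ (n - 1) * ((deriv ^^ (n - 1)) h z - (deriv ^^ (n - 1)) h 0))))"
    proof -
      have "{..<P} = insert 0 {1..L}" by (auto simp: P_def)
      moreover have "\<epsilon> * (b n * \<epsilon> ^ (n - 1) * ((deriv ^^ (n - 1)) h z - (deriv ^^ (n - 1)) h 0))
         = b n * \<epsilon> ^ n * (f n z - f n 0)" if "n \<in> {1..L}" for n
        using that by (cases n) (auto simp: f_def)
      moreover have "\<epsilon> * (of_nat M / z * (G z - G 0)) = f 0 z - f 0 0"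
        using z M by (simp add: \<epsilon>_def f_def)
      ultimately show ?thesis
        by (simp add: right_diff_distrib distrib_left sum_distrib_left b_def bernpoly_0)
    qed
    ultimately have "norm \<epsilon> * norm (H - (of_nat M / z * (G z - G 0)
          + (\<Sum>n=1..L. b n * \<epsilon> ^ (n - 1) * ((deriv ^^ (n - 1)) h z - (deriv ^^ (n - 1)) h 0))))
          \<le> norm \<epsilon> * (real M * (em_const P x * B * norm \<epsilon> ^ P))"
      by (simp only: norm_mult) (simp add: algebra_simps)
    then have "norm (H - (of_nat M / z * (G z - G 0)
          + (\<Sum>n=1..L. b n * \<epsilon> ^ (n - 1) * ((deriv ^^ (n - 1)) h z - (deriv ^^ (n - 1)) h 0))))
          \<le> real M * (em_const P x * B * norm \<epsilon> ^ P)"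
      using \<epsilon> mult_le_cancel_left_pos by auto
    also have "\<dots> = em_const P x * B * norm z ^ P / real M ^ L"
      using M by (simp add: \<epsilon>_def norm_divide power_divide P_def)
    also have "\<dots> \<le> em_const P x * B * R ^ P / real M ^ L"
      using R[OF z(1)] B0 em_const_pos[of P x]
      by (intro divide_right_mono mult_left_mono power_mono) (auto intro: less_imp_le)
    finally show "norm ((\<Sum>m<M. h ((of_nat m + of_real x) * (z / of_nat M)))
       - (of_nat M / z * (G z - G 0)
          + (\<Sum>n=1..L. bernpoly n (of_real x) / fact n * (z / of_nat M) ^ (n - 1)
              * ((deriv ^^ (n - 1)) h z - (deriv ^^ (n - 1)) h 0))))
      \<le> em_const P x * B * R ^ P / real M ^ L"
      unfolding H_def b_def \<epsilon>_def .
  qed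
qed

text \<open>The explicit dilogarithm primitives can be differentiated directly only for Re u < 0; at
  the apex of the wedge only continuity is at hand. A primitive F exists on the whole convex set,
  and G - F is continuous with zero derivative off a finite set, hence constant, so G inherits
  differentiability from F.\<close>

lemma primitive_extends_across_finite_set:
  fixes h G :: "complex \<Rightarrow> complex"
  assumes S: "convex S" and X: "finite X"
    and h: "continuous_on S h" "\<And>u. u \<in> interior S - X \<Longrightarrow> h field_differentiable at u"
    and G: "continuous_on S G"
      "\<And>u. u \<in> S - X \<Longrightarrow> (G has_field_derivative h u) (at u within S)"
    and u: "u \<in> S"
  shows "(G has_field_derivative h u) (at u within S)"
proof -
  obtain F where F: "\<And>u. u \<in> S \<Longrightarrow> (F has_field_derivative h u) (at u within S)"
    using holomorphic_convex_primitive[OF S X h] by blast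
  have const: "G v - F v = G u - F u" if "v \<in> S" for v
  proof (rule has_derivative_zero_unique_strong_convex[OF S X _ u refl _ that])
    show "continuous_on S (\<lambda>v. G v - F v)"
      by (intro continuous_on_diff G(1) DERIV_continuous_on[OF F])
    show "((\<lambda>v. G v - F v) has_derivative (\<lambda>_. 0)) (at v within S)" if "v \<in> S - X" for v
      using DERIV_diff[OF G(2)[OF that] F] that
      by (simp add: has_field_derivative_def lambda_zero)
  qed
  have "((\<lambda>v. F v + (G u - F u)) has_field_derivative h u) (at u within S)"
    using DERIV_add[OF F[OF u] DERIV_const] by simp
  moreover have "F v + (G u - F u) = G v" if "v \<in> S" for v
    using const[OF that] by (simp add: algebra_simps)
  ultimately show ?thesis
    using has_field_derivative_transform_within[OF _ zero_less_one u] by blast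
qed

section \<open>Stirling series\<close>

text \<open>The primitive $u\log u - u$ of the logarithm and its iterated derivatives.\<close>
definition ln_family :: "nat \<Rightarrow> complex \<Rightarrow> complex" where
  "ln_family n u = (if n = 0 then u * Ln u - u else if n = 1 then Ln u
     else (-1) ^ n * fact (n - 2) / u ^ (n - 1))"

lemma ln_family_has_derivative:
  assumes "Re u > 0"
  shows "(ln_family n has_field_derivative ln_family (Suc n) u) (at u within S)"
proof -
  from assms have u: "u \<noteq> 0" "u \<notin> \<real>\<^sub>\<le>\<^sub>0"
    by (auto simp: complex_nonpos_Reals_iff)
  consider "n = 0" | "n = 1" | i where "n = i + 2"
    by (metis One_nat_def add_2_eq_Suc' not0_implies_Suc)
  then show ?thesis
  proof cases
    case 1
    have "((\<lambda>u. u * Ln u - u) has_field_derivative Ln u) (at u within S)"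
      using u by (auto intro!: derivative_eq_intros)
    then show ?thesis using 1 by (simp add: ln_family_def[abs_def])
  next
    case 2
    have "(Ln has_field_derivative 1 / u) (at u within S)"
      using u by (auto intro!: derivative_eq_intros simp: divide_inverse)
    then show ?thesis using 2 by (simp add: ln_family_def[abs_def])
  next
    case 3
    have "((\<lambda>u. (-1) ^ i * fact i / u ^ Suc i) has_field_derivative
        (-1) ^ Suc i * fact (Suc i) / u ^ Suc (Suc i)) (at u within S)"
      using DERIV_cmult[OF DERIV_power_Suc[OF DERIV_inverse[OF u(1)]], of "(-1) ^ i * fact i" i S]
      by (simp add: divide_inverse power_inverse algebra_simps)
    then show ?thesis using 3 by (simp add: ln_family_def[abs_def])
  qed
qed

text \<open>This is log M! minus its Stirling approximation without the additive constant; the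
  constant is recovered as the limit for growing M.\<close>

definition stirling_error :: "nat \<Rightarrow> nat \<Rightarrow> complex" where
  "stirling_error L M = (\<Sum>j<M. Ln (of_nat (Suc j)))
     - (\<Sum>n<Suc L. bernpoly n 1 / fact n * ln_family n (of_nat M))"

text \<open>One Euler-Maclaurin step of length 1 with x = 1, so that the sampled value is Ln (m +
  1). On the half-plane Re u >= m the derivative in the remainder is at most L!/m^(L+1).\<close>

lemma stirling_error_step:
  assumes "m \<ge> 1"
  shows "norm (stirling_error L (Suc m) - stirling_error L m)
    \<le> em_const (Suc L) 1 * fact L / real m ^ Suc L"
proof -
  define S where "S = {u :: complex. Re u \<ge> real m}"
  have S: "convex S"
    unfolding S_def by (rule convex_halfspace_Re_ge)
  have "norm (1 * ln_family 1 (of_nat m + of_real 1 * 1)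
           - (\<Sum>n<Suc L. bernpoly n (of_real 1) / fact n * 1 ^ n * (ln_family n (of_nat m + 1) - ln_family n (of_nat m))))
        \<le> em_const (Suc L) (of_real 1) * (fact L / real m ^ Suc L) * norm (1::complex) ^ (Suc L + 1)"
  proof (rule euler_maclaurin_step[OF S])
    fix u assume u: "u \<in> S"
    show "(ln_family i has_field_derivative ln_family (Suc i) u) (at u within S)" for i
      using u assms by (intro ln_family_has_derivative) (auto simp: S_def)
    have "real m \<le> norm u"
      using u complex_Re_le_cmod[of u] by (auto simp: S_def)
    then have "fact L / norm u ^ Suc L \<le> fact L / real m ^ Suc L"
      using assms by (intro divide_left_mono power_mono mult_pos_pos zero_less_power) auto
    then show "norm (ln_family (Suc (Suc L)) u) \<le> fact L / real m ^ Suc L"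
      by (simp add: ln_family_def norm_mult norm_divide norm_power)
  qed (auto simp: S_def)
  moreover have "stirling_error L (Suc m) - stirling_error L m = Ln (of_nat (Suc m))
      - (\<Sum>n<Suc L. bernpoly n 1 / fact n * (ln_family n (of_nat m + 1) - ln_family n (of_nat m)))"
    by (simp add: stirling_error_def sum_subtractf right_diff_distrib algebra_simps del: sum.lessThan_Suc
        add: sum.lessThan_Suc[of _ m])
  ultimately show ?thesis
    by (simp add: ln_family_def[of "Suc 0"] add.commute del: sum.lessThan_Suc)
qed

text \<open>For m >= M, the bound m^(-L-1) is at most M^(1-L) / m^2, and 1/m^2 <= 2 (1/m - 1/(m+1))
  telescopes. The difference 1/M - 1/M' is kept because the induction needs it.\<close>

lemma stirling_error_diff:
  assumes "1 \<le> M" "M \<le> M'" "L \<ge> 1"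
  shows "norm (stirling_error L M' - stirling_error L M)
    \<le> 2 * (em_const (Suc L) 1 * fact L) / real M ^ (L - 1) * (1 / real M - 1 / real M')"
  using assms(2)
proof (induction M' rule: dec_induct)
  case base
  then show ?case by simp
next
  case (step m)
  define c where "c = em_const (Suc L) 1 * fact L"
  have c: "c \<ge> 0" using em_const_pos[of "Suc L" 1] by (simp add: c_def)
  have m: "m \<ge> 1" using step assms by simp
  have "1 / real m ^ Suc L = 1 / real m ^ (L - 1) * (1 / real m ^ 2)"
    using assms by (simp add: power_add[symmetric] flip: power_Suc)
  also have "\<dots> \<le> 1 / real M ^ (L - 1) * (2 * (1 / real m - 1 / real (Suc m)))"
  proof (rule mult_mono)
    show "1 / real m ^ (L - 1) \<le> 1 / real M ^ (L - 1)"
      using step assms by (intro divide_left_mono power_mono mult_pos_pos) auto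
    have "2 / (2 * real m ^ 2) \<le> 2 / (real m * real (Suc m))"
      using m by (intro divide_left_mono) (auto simp: power2_eq_square)
    also have "\<dots> = 2 * (1 / real m - 1 / real (Suc m))"
      using m by (simp add: field_simps)
    finally show "1 / real m ^ 2 \<le> 2 * (1 / real m - 1 / real (Suc m))"
      by simp
  qed auto
  finally have "c * (1 / real m ^ Suc L) \<le> c * (1 / real M ^ (L - 1) * (2 * (1 / real m - 1 / real (Suc m))))"
    using c by (rule mult_left_mono)
  moreover have "norm (stirling_error L (Suc m) - stirling_error L m) \<le> c * (1 / real m ^ Suc L)"
    using stirling_error_step[OF m, of L] by (simp add: c_def)
  moreover have "c * (1 / real M ^ (L - 1) * (2 * (1 / real m - 1 / real (Suc m))))
      = 2 * c / real M ^ (L - 1) * (1 / real m - 1 / real (Suc m))"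
    by (simp only: times_divide_eq_left times_divide_eq_right mult_1 mult_ac)
  ultimately have "norm (stirling_error L (Suc m) - stirling_error L m)
      \<le> 2 * c / real M ^ (L - 1) * (1 / real m - 1 / real (Suc m))"
    by linarith
  then have "norm ((stirling_error L (Suc m) - stirling_error L m) + (stirling_error L m - stirling_error L M))
      \<le> 2 * c / real M ^ (L - 1) * (1 / real m - 1 / real (Suc m))
       + 2 * c / real M ^ (L - 1) * (1 / real M - 1 / real m)"
    using step.IH by (intro norm_triangle_mono) (auto simp: c_def)
  then show ?case
    unfolding c_def[symmetric] by (simp only: right_diff_distrib) simp
qed

lemma stirling_error_le:
  assumes "1 \<le> M" "M \<le> M'" "L \<ge> 1"
  shows "norm (stirling_error L M' - stirling_error L M)
    \<le> 2 * (em_const (Suc L) 1 * fact L) / real M ^ L"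
proof -
  have "norm (stirling_error L M' - stirling_error L M)
    \<le> 2 * (em_const (Suc L) 1 * fact L) / real M ^ (L - 1) * (1 / real M - 1 / real M')"
    by (rule stirling_error_diff[OF assms])
  also have "\<dots> \<le> 2 * (em_const (Suc L) 1 * fact L) / real M ^ (L - 1) * (1 / real M)"
    using em_const_pos[of "Suc L" 1] by (intro mult_left_mono) auto
  also have "\<dots> = 2 * (em_const (Suc L) 1 * fact L) / real M ^ L"
    using assms by (cases L) auto
  finally show ?thesis .
qed

text \<open>Wallis' partial product rewritten in factorials and cleared of denominators, so that
  taking logarithms produces ln (n!) and ln ((2n)!), the quantities in Stirling's formula.\<close>

lemma wallis_product_closed_form:
  "(\<Prod>k=1..n. (4*real k^2) / (4*real k^2 - 1)) * (fact (2*n) ^ 2 * (2 * real n + 1)) = 16 ^ n * fact n ^ 4"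
proof (induction n)
  case (Suc n)
  define W where "W = (\<Prod>k=1..n. (4*real k^2) / (4*real k^2 - 1))"
  have ne: "4 * real (Suc n) ^ 2 - 1 = (2 * real n + 1) * (2 * real n + 3)"
    by (simp add: power2_eq_square algebra_simps)
  have f: "fact (2 * Suc n) = (2 * real n + 2) * (2 * real n + 1) * fact (2 * n)"
    by (simp add: algebra_simps)
  have "W * (4 * real (Suc n) ^ 2 / (4 * real (Suc n) ^ 2 - 1)) * (fact (2 * Suc n) ^ 2 * (2 * real (Suc n) + 1))
     = W * (fact (2 * n) ^ 2 * (2 * real n + 1)) * (16 * real (Suc n) ^ 4)"
  proof -
    have "W * (4 * a ^ 2 / (x * y)) * ((2 * a * x * F) ^ 2 * y) = W * (F ^ 2 * x) * (16 * a ^ 4)"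
      if "x \<noteq> 0" "y \<noteq> 0" for a x y F :: real
      using that by (simp add: field_simps power2_eq_square power4_eq_xxxx)
    from this[of "2 * real n + 1" "2 * real n + 3" "real (Suc n)" "fact (2 * n)"]
    show ?thesis
      unfolding ne f by (simp add: algebra_simps)
  qed
  also have "\<dots> = 16 ^ Suc n * fact (Suc n) ^ 4"
    unfolding W_def Suc.IH by (simp add: power_mult_distrib)
  finally show ?case
    by (simp add: W_def del: fact_Suc)
qed simp

lemma stirling_error_1: "stirling_error 1 M
   = of_real (ln (fact M) - (real M * ln (real M) - real M + ln (real M) / 2))" if "M \<ge> 1"
proof -
  have *: "Ln (of_nat j) = of_real (ln (real j))" if "j \<ge> 1" for j
    using Ln_of_real[of "real j"] that by simp
  have "(\<Sum>j<M. Ln (of_nat (Suc j))) = of_real (\<Sum>j<M. ln (real (Suc j)))"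
    unfolding of_real_sum by (intro sum.cong refl *) auto
  also have "(\<Sum>j<M. ln (real (Suc j))) = ln (fact M)"
    by (induction M) (simp_all add: ln_mult del: of_nat_Suc)
  finally show ?thesis
    using *[OF that] bernpoly_1[of 1]
    by (simp add: stirling_error_def ln_family_def bernpoly_0 algebra_simps)
qed

text \<open>
  The limit exists because the error is Cauchy; Wallis' product identifies it through
  $t(2M) - 2\,t(M)$.
\<close>
lemma stirling_error_1_tendsto: "stirling_error 1 \<longlonglongrightarrow> of_real (ln (2 * pi) / 2)"
proof -
  define t where "t M = ln (fact M) - (real M * ln (real M) - real M + ln (real M) / 2)" for M :: nat
  have st: "stirling_error 1 M = of_real (t M)" if "M \<ge> 1" for M
    using stirling_error_1[OF that] by (simp add: t_def)
  define c where "c = 2 * (em_const (Suc 1) 1 * fact 1)"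
  have "Cauchy t"
  proof (rule metric_CauchyI)
    fix e :: real assume e: "e > 0"
    obtain M1 :: nat where M1: "real M1 > \<bar>c\<bar> / e"
      using reals_Archimedean2 by blast
    define M0 where "M0 = Suc M1"
    have M0: "real M0 > \<bar>c\<bar> / e" "M0 \<ge> 1"
      using M1 by (auto simp: M0_def)
    have *: "dist (t m) (t n) < e" if "M0 \<le> m" "m \<le> n" for m n
    proof -
      have "dist (t m) (t n) = norm (stirling_error 1 n - stirling_error 1 m)"
        using st[of m] st[of n] that M0
        by (simp add: dist_norm norm_minus_commute flip: of_real_diff)
      also have "\<dots> \<le> c / real m ^ 1"
        unfolding c_def by (rule stirling_error_le) (use that M0 in auto)
      also have "\<dots> \<le> \<bar>c\<bar> / real M0"
        using that M0 by (simp add: frac_le)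
      also have "\<dots> < e"
        using M0 e by (simp add: field_simps)
      finally show ?thesis .
    qed
    show "\<exists>M. \<forall>m\<ge>M. \<forall>n\<ge>M. dist (t m) (t n) < e"
      using * by (metis dist_commute nat_le_linear)
  qed
  then obtain l where l: "t \<longlonglongrightarrow> l"
    using Cauchy_convergent convergent_def by blast
  have sub: "(\<lambda>M. t (2 * M)) \<longlonglongrightarrow> l"
    using LIMSEQ_subseq_LIMSEQ[OF l, of "\<lambda>M. 2 * M"] by (simp add: strict_mono_def o_def)
  define W where "W n = (\<Prod>k=1..n. (4*real k^2) / (4*real k^2 - 1))" for n :: nat
  \<comment> \<open>Besides ln (W n), these are the terms left in -2 (t(2n) - 2 t(n)) after
    cancellation. If t tends to l, that expression tends to 2l, while the limit here equals ln (2
    pi).\<close>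
  have W: "(\<lambda>n. ln (W n) + ln ((2 * real n + 1) / real n) + ln 2) \<longlonglongrightarrow> ln (pi / 2) + ln 2 + ln 2"
  proof (intro tendsto_intros)
    show "W \<longlonglongrightarrow> pi / 2"
      unfolding W_def by (rule wallis)
    show "(\<lambda>n. (2 * real n + 1) / real n) \<longlonglongrightarrow> 2"
      by real_asymp
  qed auto
  have "ln (W n) + ln ((2 * real n + 1) / real n) + ln 2 = -2 * (t (2 * n) - 2 * t n)" if "n \<ge> 1" for n
  proof -
    have eq: "W n * (fact (2*n) ^ 2 * (2 * real n + 1)) = 16 ^ n * fact n ^ 4"
      unfolding W_def by (rule wallis_product_closed_form)
    have "W n > 0"
    proof -
      have "W n * (fact (2*n) ^ 2 * (2 * real n + 1)) > 0"
        unfolding eq by simp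
      then show ?thesis
        by (rule zero_less_mult_pos2) simp
    qed
    then have "ln (W n) + (2 * ln (fact (2*n)) + ln (2 * real n + 1)) = real n * ln 16 + 4 * ln (fact n)"
      using arg_cong[OF eq, of ln] by (simp add: ln_mult ln_realpow)
    moreover have "ln 16 = 4 * ln (2::real)"
      using ln_realpow[of 2 4] by simp
    moreover have "ln ((2 * real n + 1) / real n) = ln (2 * real n + 1) - ln (real n)"
      using that by (simp add: ln_div)
    moreover have "ln (2 * real n) = ln 2 + ln (real n)"
      using that by (simp add: ln_mult)
    ultimately show ?thesis
      by (simp add: t_def field_simps)
  qed
  then have "eventually (\<lambda>n. ln (W n) + ln ((2 * real n + 1) / real n) + ln 2 = -2 * (t (2 * n) - 2 * t n)) sequentially"
    using eventually_ge_at_top[of 1] by (rule eventually_mono[rotated]) blast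
  then have "(\<lambda>n. -2 * (t (2 * n) - 2 * t n)) \<longlonglongrightarrow> ln (pi / 2) + ln 2 + ln 2"
    using W by (rule Lim_transform_eventually[rotated])
  moreover have "(\<lambda>n. -2 * (t (2 * n) - 2 * t n)) \<longlonglongrightarrow> -2 * (l - 2 * l)"
    by (intro tendsto_intros sub l)
  ultimately have "-2 * (l - 2 * l) = ln (pi / 2) + ln 2 + ln 2"
    using LIMSEQ_unique by blast
  also have "\<dots> = ln (2 * pi)"
    by (simp add: ln_mult ln_div)
  finally have "l = ln (2 * pi) / 2" by simp
  with l have "(\<lambda>M. complex_of_real (t M)) \<longlonglongrightarrow> of_real (ln (2 * pi) / 2)"
    by (intro tendsto_of_real) simp
  moreover have "eventually (\<lambda>M. complex_of_real (t M) = stirling_error 1 M) sequentially"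
    using eventually_ge_at_top[of 1] by (rule eventually_mono) (use st in auto)
  ultimately show ?thesis
    by (rule Lim_transform_eventually)
qed

text \<open>Raising L beyond 1 only subtracts terms with n >= 2, which decay like M^(1-n); the limit
  is therefore the one found for L = 1.\<close>

lemma stirling_error_tendsto:
  assumes "L \<ge> 1"
  shows "stirling_error L \<longlonglongrightarrow> of_real (ln (2 * pi) / 2)"
proof -
  have split: "{..<Suc L} = {..<Suc 1} \<union> {2..L}"
    using assms by auto
  have "stirling_error L = (\<lambda>M. stirling_error 1 M - (\<Sum>n=2..L. bernpoly n 1 / fact n * ln_family n (of_nat M)))"
    unfolding stirling_error_def split by (subst sum.union_disjoint) (auto simp: fun_eq_iff)
  moreover have "(\<lambda>M. ln_family n (of_nat M)) \<longlonglongrightarrow> 0" if "n \<in> {2..L}" for n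
  proof -
    have "(\<lambda>M. inverse (of_nat M) ^ (n - 1)) \<longlonglongrightarrow> (0::complex) ^ (n - 1)"
      by (intro tendsto_power lim_inverse_n)
    then have "(\<lambda>M. ((-1) ^ n * fact (n - 2)) * inverse (of_nat M) ^ (n - 1)) \<longlonglongrightarrow> ((-1) ^ n * fact (n - 2)) * (0::complex)"
      using that by (intro tendsto_mult_left) (simp add: power_0_left)
    then show ?thesis
      using that by (simp add: ln_family_def divide_inverse power_inverse)
  qed
  then have "(\<lambda>M. stirling_error 1 M - (\<Sum>n=2..L. bernpoly n 1 / fact n * ln_family n (of_nat M)))
      \<longlonglongrightarrow> of_real (ln (2 * pi) / 2) - (\<Sum>n=2..L. bernpoly n 1 / fact n * 0)"
    by (intro tendsto_intros stirling_error_1_tendsto)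
  ultimately show ?thesis by simp
qed

text \<open>The bound in \<open>stirling_error_le\<close> does not involve M', so letting M' tend to
  infinity replaces \<open>stirling_error L M'\<close> by the constant.\<close>

lemma stirling_expansion:
  assumes "L \<ge> 1"
  shows "\<exists>K. \<forall>M\<ge>1. norm ((\<Sum>j<M. Ln (of_nat (Suc j)))
     - (of_nat M * Ln (of_nat M) - of_nat M + Ln (of_nat M) / 2 + of_real (ln (2 * pi)) / 2
        + (\<Sum>n=2..L. bernpoly n 1 / fact n * ((-1) ^ n * fact (n - 2) / of_nat M ^ (n - 1)))))
     \<le> K / real M ^ L"
proof (intro exI allI impI)
  fix M :: nat assume M: "M \<ge> 1"
  have le: "norm (of_real (ln (2 * pi) / 2) - stirling_error L M) \<le> 2 * (em_const (Suc L) 1 * fact L) / real M ^ L"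
  proof (rule Lim_bounded)
    show "(\<lambda>M'. norm (stirling_error L M' - stirling_error L M)) \<longlonglongrightarrow> norm (of_real (ln (2 * pi) / 2) - stirling_error L M)"
      by (intro tendsto_intros stirling_error_tendsto assms)
    show "\<forall>M'\<ge>M. norm (stirling_error L M' - stirling_error L M) \<le> 2 * (em_const (Suc L) 1 * fact L) / real M ^ L"
      using stirling_error_le M assms by blast
  qed
  have *: "(\<Sum>n<Suc L. bernpoly n 1 / fact n * ln_family n (of_nat M))
     = of_nat M * Ln (of_nat M) - of_nat M + Ln (of_nat M) / 2
       + (\<Sum>n=2..L. bernpoly n 1 / fact n * ((-1) ^ n * fact (n - 2) / of_nat M ^ (n - 1)))"
  proof -
    have split: "{..<Suc L} = insert 0 (insert 1 {2..L})"
      using assms by auto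
    have "(\<Sum>n=2..L. bernpoly n 1 / fact n * ln_family n (of_nat M))
      = (\<Sum>n=2..L. bernpoly n 1 / fact n * ((-1) ^ n * fact (n - 2) / of_nat M ^ (n - 1)))"
      by (intro sum.cong) (auto simp: ln_family_def)
    then show ?thesis
      unfolding split using bernpoly_1[of 1] by (simp add: bernpoly_0 ln_family_def[of 0] ln_family_def[of "Suc 0"])
  qed
  have "(\<Sum>j<M. Ln (of_nat (Suc j)))
     - (of_nat M * Ln (of_nat M) - of_nat M + Ln (of_nat M) / 2 + of_real (ln (2 * pi)) / 2
        + (\<Sum>n=2..L. bernpoly n 1 / fact n * ((-1) ^ n * fact (n - 2) / of_nat M ^ (n - 1))))
     = - (of_real (ln (2 * pi) / 2) - stirling_error L M)"
    unfolding stirling_error_def * by simp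
  then show "norm ((\<Sum>j<M. Ln (of_nat (Suc j)))
     - (of_nat M * Ln (of_nat M) - of_nat M + Ln (of_nat M) / 2 + of_real (ln (2 * pi)) / 2
        + (\<Sum>n=2..L. bernpoly n 1 / fact n * ((-1) ^ n * fact (n - 2) / of_nat M ^ (n - 1)))))
     \<le> 2 * (em_const (Suc L) 1 * fact L) / real M ^ L"
    using le by (simp only: norm_minus_cancel)
qed

section \<open>Polylogarithms\<close>

lemma inverse_squares_Suc_summable: "summable (\<lambda>n. 1 / (real (Suc n))\<^sup>2)"
  using inverse_power_summable[of 2, where 'a = real]
  by (subst summable_Suc_iff) (simp add: inverse_eq_divide)

lemma norm_Li2_term_le:
  assumes "norm w \<le> 1"
  shows "norm (w ^ Suc n / (of_nat (Suc n))\<^sup>2 :: complex) \<le> 1 / (real (Suc n))\<^sup>2"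
proof -
  have "norm (w ^ Suc n) \<le> 1"
    using assms by (simp only: norm_power) (rule power_le_one, auto)
  then show ?thesis
    unfolding norm_divide norm_power norm_of_nat by (rule divide_right_mono) simp
qed

lemma Li2_sums:
  assumes "norm w \<le> 1"
  shows "(\<lambda>n. w ^ Suc n / (of_nat (Suc n))\<^sup>2) sums Li2 w"
  unfolding Li2_def
  by (intro summable_sums summable_comparison_test'[OF inverse_squares_Suc_summable, of 0] norm_Li2_term_le assms)

text \<open>The boundary circle is included because the apex u = 0 of the wedge is sent to w with
  |w| = 1.\<close>

lemma continuous_on_Li2: "continuous_on (cball 0 1) Li2"
proof -
  have "uniform_limit (cball 0 1) (\<lambda>n w. \<Sum>i<n. w ^ Suc i / (of_nat (Suc i))\<^sup>2) Li2 sequentially"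
    unfolding Li2_def
    by (rule Weierstrass_m_test[OF _ inverse_squares_Suc_summable])
      (use norm_Li2_term_le in \<open>auto simp del: power_Suc of_nat_Suc\<close>)
  then show ?thesis
    by (rule uniform_limit_theorem[rotated])
      (auto intro!: always_eventually continuous_intros simp del: of_nat_Suc)
qed

lemma Li2_has_derivative:
  assumes "norm w < 1" "w \<noteq> 0"
  shows "(Li2 has_field_derivative - Ln (1 - w) / w) (at w)"
proof -
  \<comment> \<open>Division by zero gives \<open>c 0 = 0\<close>, so the series may start at n = 0.
    The same convention removes the term n = 0 of the logarithm series below.\<close>
  define c :: "nat \<Rightarrow> complex" where "c n = 1 / (of_nat n)\<^sup>2" for n
  have Li2_eq: "Li2 v = (\<Sum>n. c n * v ^ n)" if "norm v \<le> 1" for v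
  proof -
    have "(\<lambda>n. c n * v ^ n) sums Li2 v"
      using sums_Suc[of "\<lambda>n. c n * v ^ n" "Li2 v"] Li2_sums[OF that]
      by (simp add: c_def del: power_Suc of_nat_Suc)
    then show ?thesis by (simp add: sums_iff)
  qed
  have "summable (\<lambda>n. c n * 1 ^ n)"
    using inverse_power_summable[of 2, where 'a = complex] by (simp add: c_def inverse_eq_divide)
  then have D: "((\<lambda>v. \<Sum>n. c n * v ^ n) has_field_derivative (\<Sum>n. diffs c n * w ^ n)) (at w)"
    by (rule termdiffs_strong) (use assms in auto)
  have "(\<lambda>n. - (w ^ n) / of_nat n) sums ln (1 - w)"
    using Ln_series'[of "-w"] assms by simp
  then have "(\<lambda>n. - (- (w ^ n) / of_nat n) / w) sums (- Ln (1 - w) / w)"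
    by (intro sums_divide sums_minus)
  then have "(\<lambda>n. - (- (w ^ Suc n) / of_nat (Suc n)) / w) sums (- Ln (1 - w) / w)"
    by (subst sums_Suc_iff) simp
  moreover have "- (- (w ^ Suc n) / of_nat (Suc n)) / w = diffs c n * w ^ n" for n
    using assms by (simp add: diffs_def c_def power2_eq_square divide_simps del: of_nat_Suc)
  ultimately have "(\<lambda>n. diffs c n * w ^ n) sums (- Ln (1 - w) / w)"
    by simp
  then have "(\<Sum>n. diffs c n * w ^ n) = - Ln (1 - w) / w"
    by (simp add: sums_iff)
  moreover have "\<forall>\<^sub>F v in nhds w. (\<Sum>n. c n * v ^ n) = Li2 v"
  proof (rule eventually_nhds_in_open[of "ball 0 1" w, THEN eventually_mono])
    show "(\<Sum>n. c n * v ^ n) = Li2 v" if "v \<in> ball 0 1" for v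
      using Li2_eq[of v] that by (simp add: less_imp_le)
  qed (use assms in auto)
  ultimately show ?thesis
    using D by (simp add: DERIV_cong_ev[OF refl _ refl])
qed

lemma norm_root_of_unity:
  fixes \<rho> :: complex
  assumes "\<rho> ^ k = 1" "k \<ge> 1"
  shows "norm \<rho> = 1"
proof -
  have "norm \<rho> ^ k = 1 ^ k"
    using arg_cong[OF assms(1), of norm] by (simp add: norm_power)
  then show ?thesis
    using assms(2) by (subst (asm) power_eq_iff_eq_base) auto
qed

text \<open>Orthogonality of the k-th roots of unity: if k does not divide n, primitivity gives
  \<rho>^n \<noteq> 1, and the geometric sum has numerator (\<rho>^n)^k - 1 = 0.\<close>

lemma sum_powers_root_of_unity:
  fixes \<rho> :: complex
  assumes \<rho>: "\<rho> ^ k = 1" "\<forall>m. 0 < m \<and> m < k \<longrightarrow> \<rho> ^ m \<noteq> 1" and k: "k \<ge> 1"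
  shows "(\<Sum>r=1..k. (\<rho> ^ r) ^ n) = (if k dvd n then of_nat k else 0)"
proof (cases "k dvd n")
  case True
  then have "\<rho> ^ n = 1"
    using \<rho>(1) by (auto simp: dvd_def power_mult)
  then have "(\<rho> ^ r) ^ n = 1" for r
    by (metis power_mult mult.commute power_one)
  with True show ?thesis by simp
next
  case False
  have "\<rho> ^ n = \<rho> ^ (k * (n div k) + n mod k)"
    by simp
  also have "\<dots> = \<rho> ^ (n mod k)"
    using \<rho>(1) by (simp only: power_add power_mult) simp
  finally have ne: "\<rho> ^ n \<noteq> 1"
    using \<rho>(2)[rule_format, of "n mod k"] False k by (simp add: dvd_eq_mod_eq_0)
  have "(\<Sum>r=1..k. (\<rho> ^ r) ^ n) = (\<Sum>r<k. \<rho> ^ n * (\<rho> ^ n) ^ r)"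
    by (simp add: sum.atLeast1_atMost_eq power_mult_distrib flip: power_mult power_Suc)
      (simp add: mult.commute power_add)
  also have "\<dots> = \<rho> ^ n * (\<Sum>r<k. (\<rho> ^ n) ^ r)"
    by (simp add: sum_distrib_left)
  also have "(\<Sum>r<k. (\<rho> ^ n) ^ r) = ((\<rho> ^ n) ^ k - 1) / (\<rho> ^ n - 1)"
    using geometric_sum[OF ne] by simp
  also have "(\<rho> ^ n) ^ k = 1"
    by (metis power_mult mult.commute power_one \<rho>(1))
  finally show ?thesis using False by simp
qed

text \<open>Summing over r keeps only the exponents km, each with weight k, and k/(km)^2 = 1/(k m^2)
  accounts for the factor 1/k.\<close>

lemma Li2_multisection:
  fixes \<rho> :: complex
  assumes \<rho>: "\<rho> ^ k = 1" "\<forall>m. 0 < m \<and> m < k \<longrightarrow> \<rho> ^ m \<noteq> 1" and k: "k \<ge> 1" and w: "norm w \<le> 1"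
  shows "(\<Sum>r=1..k. Li2 (\<rho> ^ r * w)) = Li2 (w ^ k) / of_nat k"
proof -
  have "norm \<rho> = 1"
    using norm_root_of_unity[OF \<rho>(1) k] .
  then have w': "norm (\<rho> ^ r * w) \<le> 1" for r
    using w by (simp add: norm_mult norm_power)
  define F where "F n = (if k dvd Suc n then of_nat k * w ^ Suc n / (of_nat (Suc n))\<^sup>2 else 0)" for n
  have "(\<lambda>n. \<Sum>r=1..k. (\<rho> ^ r * w) ^ Suc n / (of_nat (Suc n))\<^sup>2) sums (\<Sum>r=1..k. Li2 (\<rho> ^ r * w))"
    by (intro sums_sum Li2_sums w')
  also have "(\<lambda>n. \<Sum>r=1..k. (\<rho> ^ r * w) ^ Suc n / (of_nat (Suc n))\<^sup>2) = F"
  proof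
    fix n
    have "(\<Sum>r=1..k. (\<rho> ^ r * w) ^ Suc n / (of_nat (Suc n))\<^sup>2)
       = (\<Sum>r=1..k. (\<rho> ^ r) ^ Suc n) * (w ^ Suc n / (of_nat (Suc n))\<^sup>2)"
      unfolding sum_distrib_right by (simp only: power_mult_distrib times_divide_eq_right)
    also have "\<dots> = F n"
      unfolding sum_powers_root_of_unity[OF \<rho> k] F_def by simp
    finally show "(\<Sum>r=1..k. (\<rho> ^ r * w) ^ Suc n / (of_nat (Suc n))\<^sup>2) = F n" .
  qed
  finally have 1: "F sums (\<Sum>r=1..k. Li2 (\<rho> ^ r * w))" .
  \<comment> \<open>Index n of the series carries the exponent n + 1, so the surviving exponents
    k(m+1) sit at the indices k(m+1) - 1.\<close>
  define g where "g m = k * Suc m - 1" for m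
  have Sg: "Suc (g m) = k * Suc m" for m
    using k by (simp add: g_def)
  have "strict_mono g"
  proof (rule strict_monoI)
    fix a b :: nat assume "a < b"
    then have "Suc (g a) < Suc (g b)"
      unfolding Sg using k by simp
    then show "g a < g b" by simp
  qed
  moreover have "F n = 0" if "n \<notin> range g" for n
  proof -
    have "\<not> k dvd Suc n"
    proof
      assume "k dvd Suc n"
      then obtain q where q: "Suc n = k * q" by (auto simp: dvd_def)
      then obtain q' where "q = Suc q'" by (cases q) auto
      with q have "Suc n = Suc (g q')" by (simp only: Sg)
      with that show False by auto
    qed
    then show ?thesis by (simp add: F_def)
  qed
  ultimately have 2: "(\<lambda>n. F (g n)) sums (\<Sum>r=1..k. Li2 (\<rho> ^ r * w))"
    using sums_mono_reindex[of g F] 1 by blast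
  have "norm (w ^ k) \<le> 1"
    using w by (simp add: norm_power power_le_one)
  from sums_divide[OF Li2_sums[OF this], of "of_nat k"]
  have "(\<lambda>n. (w ^ k) ^ Suc n / (of_nat (Suc n))\<^sup>2 / of_nat k) sums (Li2 (w ^ k) / of_nat k)" .
  moreover have "(w ^ k) ^ Suc n / (of_nat (Suc n))\<^sup>2 / of_nat k = F (g n)" for n
    unfolding F_def Sg power_mult[symmetric] using k
    by (simp add: power2_eq_square field_simps del: of_nat_Suc mult_Suc_right power_Suc)
  ultimately show ?thesis
    using 2 sums_unique2 by simp
qed

section \<open>Polylogarithms of nonpositive order as logarithmic derivatives\<close>

lemma polylog_neg_holomorphic: "polylog_neg m holomorphic_on (-{1})"
proof (induction m)
  case 0
  have "(\<lambda>w. w / (1 - w)) holomorphic_on (-{1} :: complex set)"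
    by (intro holomorphic_intros) auto
  then show ?case by (simp add: fun_eq_iff cong: holomorphic_cong)
next
  case (Suc m)
  have "(\<lambda>w. w * deriv (polylog_neg m) w) holomorphic_on (-{1})"
    by (intro holomorphic_intros Suc.IH) auto
  then show ?case by (simp cong: holomorphic_cong)
qed

text \<open>On functions of v = w e^u the operator d/du acts as v d/dv, which is the recursion of
  \<open>polylog_neg\<close>. The sign comes from log(1 - v) = -Li_1(v).\<close>

lemma higher_deriv_Ln_one_minus_exp:
  assumes "1 - w * exp u \<notin> \<real>\<^sub>\<le>\<^sub>0"
  shows "(deriv ^^ Suc m) (\<lambda>u. Ln (1 - w * exp u)) u = - polylog_neg m (w * exp u)"
  using assms
proof (induction m arbitrary: u)
  case 0
  have "((\<lambda>u. Ln (1 - w * exp u)) has_field_derivative - polylog_neg 0 (w * exp u)) (at u)"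
    using 0 by (auto intro!: derivative_eq_intros simp: divide_inverse)
  then show ?case by (simp add: DERIV_imp_deriv)
next
  case (Suc m)
  define U where "U = {u. 1 - w * exp u \<notin> \<real>\<^sub>\<le>\<^sub>0}"
  have "open ((\<lambda>u. 1 - w * exp u) -` (- \<real>\<^sub>\<le>\<^sub>0))"
    by (intro open_vimage continuous_intros) (auto simp: closed_nonpos_Reals_complex)
  then have U: "open U" "u \<in> U"
    using Suc.prems by (auto simp: U_def vimage_def)
  have ne: "w * exp u \<noteq> 1"
    using Suc.prems by auto
  have "(deriv ^^ Suc (Suc m)) (\<lambda>u. Ln (1 - w * exp u)) u = deriv (\<lambda>u. - polylog_neg m (w * exp u)) u"
    unfolding funpow.simps(2)[of "Suc m"] o_def
    by (rule deriv_cong_ev[OF _ refl], rule eventually_mono[OF eventually_nhds_in_open[OF U]])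
      (use Suc.IH in \<open>auto simp: U_def\<close>)
  also have "\<dots> = - polylog_neg (Suc m) (w * exp u)"
  proof (rule DERIV_imp_deriv)
    have "(polylog_neg m has_field_derivative deriv (polylog_neg m) (w * exp u)) (at (w * exp u))"
      using ne by (intro holomorphic_derivI[OF polylog_neg_holomorphic]) auto
    moreover have "((\<lambda>u. w * exp u) has_field_derivative w * exp u) (at u)"
      by (auto intro!: derivative_eq_intros)
    ultimately have "((\<lambda>u. polylog_neg m (w * exp u)) has_field_derivative
        deriv (polylog_neg m) (w * exp u) * (w * exp u)) (at u)"
      by (rule DERIV_chain2)
    from DERIV_minus[OF this]
    show "((\<lambda>u. - polylog_neg m (w * exp u)) has_field_derivative - polylog_neg (Suc m) (w * exp u)) (at u)"
      by (simp add: mult.commute)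
  qed
  finally show ?case .
qed

section \<open>Logarithmic sums over the wedge\<close>

text \<open>The two half-planes say C Re u + \<delta> |Im u| <= 0. The slope C/\<delta> suffices
  because the points z in question have Re z <= -\<delta> and |Im z| <= C; the segments from 0 to
  them are then included as well. As an intersection of a disc and half-planes the set is visibly
  convex and compact.\<close>

definition wedge :: "real \<Rightarrow> real \<Rightarrow> complex set" where
  "wedge \<delta> C = cball 0 C \<inter> {u. inner (Complex C \<delta>) u \<le> 0} \<inter> {u. inner (Complex C (-\<delta>)) u \<le> 0}"

lemma convex_wedge: "convex (wedge \<delta> C)"
  unfolding wedge_def by (intro convex_Int convex_halfspace_le convex_cball)

lemma compact_wedge: "compact (wedge \<delta> C)"
  unfolding wedge_def by (intro compact_Int_closed compact_cball closed_halfspace_le)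

lemma zero_in_wedge: "C > 0 \<Longrightarrow> 0 \<in> wedge \<delta> C"
  by (simp add: wedge_def)

lemma in_wedgeI:
  assumes "Re z \<le> - \<delta>" "norm z \<le> C" "\<delta> > 0" "C > 0"
  shows "z \<in> wedge \<delta> C"
proof -
  have "\<bar>Im z\<bar> \<le> C"
    using abs_Im_le_cmod[of z] assms by simp
  then have "\<delta> * \<bar>Im z\<bar> \<le> \<delta> * C"
    using assms by simp
  moreover have "C * Re z \<le> C * (-\<delta>)"
    using assms by (intro mult_left_mono) auto
  moreover have "\<bar>\<delta> * Im z\<bar> = \<delta> * \<bar>Im z\<bar>"
    using assms by (simp add: abs_mult)
  ultimately have "C * Re z + \<delta> * Im z \<le> 0" "C * Re z - \<delta> * Im z \<le> 0"
    by (auto simp: mult.commute)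
  then show ?thesis
    using assms by (simp add: wedge_def inner_complex_def)
qed

lemma wedge_Re_neg:
  assumes "u \<in> wedge \<delta> C" "u \<noteq> 0" "\<delta> > 0" "C > 0"
  shows "Re u < 0"
proof (rule ccontr)
  assume "\<not> Re u < 0"
  then have "C * Re u \<ge> 0"
    using assms by simp
  moreover have "C * Re u + \<delta> * Im u \<le> 0" "C * Re u - \<delta> * Im u \<le> 0"
    using assms by (auto simp: wedge_def inner_complex_def)
  ultimately have "C * Re u = 0" "\<delta> * Im u = 0"
    by linarith+
  then show False
    using assms by (simp add: complex_eq_iff)
qed

text \<open>The closed unit disc meets the half-plane Re v >= 1 only at v = 1. This is what keeps
  the arguments of the logarithms off the branch cut.\<close>

lemma Re_one_minus_pos:
  assumes "norm v \<le> 1" "v \<noteq> 1"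
  shows "Re (1 - v) > 0"
proof (rule ccontr)
  assume "\<not> Re (1 - v) > 0"
  then have Re: "Re v \<ge> 1" by simp
  have "Re v ^ 2 + Im v ^ 2 \<le> 1"
    using assms(1) by (simp add: cmod_def)
  moreover have "Re v ^ 2 \<ge> 1"
    using Re by simp
  ultimately have "Im v ^ 2 \<le> 0" "Re v ^ 2 \<le> 1"
    using zero_le_power2[of "Im v"] by linarith+
  then have "Im v = 0" "Re v \<le> 1"
    using Re by (auto simp: power_le_one_iff)
  with Re assms(2) show False by (simp add: complex_eq_iff)
qed

lemma Re_one_minus_exp_pos:
  assumes "Re u < 0"
  shows "Re (1 - exp u) > 0"
proof (rule Re_one_minus_pos)
  have lt: "norm (exp u) < 1"
    using assms by simp
  then show "norm (exp u) \<le> 1"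
    by linarith
  show "exp u \<noteq> 1"
    using lt by (metis less_irrefl norm_one)
qed

lemma Li2_exp_has_derivative:
  assumes "norm w = 1" "Re u < 0"
  shows "((\<lambda>u. Li2 (w * exp u)) has_field_derivative - Ln (1 - w * exp u)) (at u within A)"
proof -
  have v: "norm (w * exp u) < 1" "w * exp u \<noteq> 0"
    using assms by (auto simp: norm_mult)
  have "((\<lambda>u. w * exp u) has_field_derivative w * exp u) (at u within A)"
    by (auto intro!: derivative_eq_intros)
  with Li2_has_derivative[OF v]
  have "((\<lambda>u. Li2 (w * exp u)) has_field_derivative - Ln (1 - w * exp u) / (w * exp u) * (w * exp u)) (at u within A)"
    by (rule DERIV_chain2)
  then show ?thesis
    using v by simp
qed

lemma continuous_on_Li2_exp:
  assumes "norm w = 1" "\<And>u. u \<in> S \<Longrightarrow> Re u \<le> 0"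
  shows "continuous_on S (\<lambda>u. Li2 (w * exp u))"
  by (rule continuous_on_compose2[OF continuous_on_Li2])
    (use assms in \<open>auto intro!: continuous_intros simp: norm_mult\<close>)

lemma nonpos_Reals_complement_vimage_open:
  fixes f :: "complex \<Rightarrow> complex"
  assumes "continuous_on UNIV f"
  shows "open {u. f u \<notin> \<real>\<^sub>\<le>\<^sub>0}"
proof -
  have "open (f -` (- \<real>\<^sub>\<le>\<^sub>0))"
    by (intro open_vimage assms open_Compl closed_nonpos_Reals_complex)
  then show ?thesis
    by (simp add: vimage_def)
qed

lemma Re_pos_not_nonpos_Reals: "Re z > 0 \<Longrightarrow> z \<notin> \<real>\<^sub>\<le>\<^sub>0"
  by (auto simp: complex_nonpos_Reals_iff)

text \<open>Since w \<noteq> 1, the function log(1 - w e^u) is holomorphic near the whole wedge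
  including its apex, so Euler-Maclaurin applies directly. The order n = 1 gives B_1(x) = x - 1/2
  times a difference of logarithms, the higher orders give polylogarithms.\<close>

lemma log_sum_expansion_regular:
  fixes x :: real
  assumes w: "norm w = 1" "w \<noteq> 1" and x: "0 \<le> x" "x \<le> 1"
    and \<delta>: "\<delta> > 0" "C > 0" and L: "L \<ge> 1"
  shows "\<exists>K. \<forall>z\<in>wedge \<delta> C. \<forall>M\<ge>1. z \<noteq> 0 \<longrightarrow>
    norm ((\<Sum>m<M. Ln (1 - w * exp ((of_nat m + of_real x) * (z / of_nat M))))
       - (- (of_nat M / z * (Li2 (w * exp z) - Li2 w))
          + (of_real x - 1/2) * (Ln (1 - w * exp z) - Ln (1 - w))
          - (\<Sum>n=2..L. bernpoly n (of_real x) / fact n * (z / of_nat M) ^ (n - 1)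
              * (polylog_neg (n - 2) (w * exp z) - polylog_neg (n - 2) w))))
    \<le> K / real M ^ L"
proof -
  define S where "S = wedge \<delta> C"
  define h where "h u = Ln (1 - w * exp u)" for u
  define U where "U = {u. 1 - w * exp u \<notin> \<real>\<^sub>\<le>\<^sub>0}"
  have Re_le: "Re u \<le> 0" if "u \<in> S" for u
    using wedge_Re_neg[of u \<delta> C] that \<delta> by (cases "u = 0") (auto simp: S_def)
  have U: "open U"
    unfolding U_def by (intro nonpos_Reals_complement_vimage_open continuous_intros)
  have hol: "h holomorphic_on U"
    unfolding h_def U_def by (intro holomorphic_intros) auto
  have SU: "S \<subseteq> U"
  proof
    fix u assume u: "u \<in> S"
    have "w * exp u \<noteq> 1"
    proof (cases "u = 0")
      case False
      then have "norm (w * exp u) < 1"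
        using wedge_Re_neg[of u \<delta> C] u \<delta> w by (auto simp: S_def norm_mult)
      then show ?thesis by auto
    qed (use w in auto)
    moreover have "norm (w * exp u) \<le> 1"
      using Re_le[OF u] w by (simp add: norm_mult)
    ultimately show "u \<in> U"
      unfolding U_def using Re_one_minus_pos Re_pos_not_nonpos_Reals by blast
  qed
  have S: "convex S" "compact S" "0 \<in> S"
    using convex_wedge compact_wedge zero_in_wedge \<delta> by (auto simp: S_def)
  \<comment> \<open>At u = 0 the argument w e^u lies on the unit circle, outside the reach of
    \<open>Li2_has_derivative\<close>; this one point is filled in by continuity.\<close>
  have G: "((\<lambda>u. - Li2 (w * exp u)) has_field_derivative h u) (at u within S)" if "u \<in> S" for u
  proof (rule primitive_extends_across_finite_set[OF S(1), of "{0}"])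
    show "continuous_on S h"
      using hol SU holomorphic_on_imp_continuous_on holomorphic_on_subset by blast
    show "h field_differentiable at u" if "u \<in> interior S - {0}" for u
      using hol U SU that interior_subset holomorphic_on_imp_differentiable_at by blast
    show "continuous_on S (\<lambda>u. - Li2 (w * exp u))"
      by (intro continuous_on_minus continuous_on_Li2_exp w Re_le)
    show "((\<lambda>u. - Li2 (w * exp u)) has_field_derivative h u) (at u within S)" if "u \<in> S - {0}" for u
    proof -
      have "Re u < 0"
        using wedge_Re_neg[of u \<delta> C] that \<delta> by (auto simp: S_def)
      from DERIV_minus[OF Li2_exp_has_derivative[OF w(1) this]] show ?thesis
        by (simp add: h_def)
    qed
  qed (use that in auto)
  obtain K where K: "\<forall>z\<in>S. \<forall>M\<ge>1. z \<noteq> 0 \<longrightarrow>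
    norm ((\<Sum>m<M. h ((of_nat m + of_real x) * (z / of_nat M)))
       - (of_nat M / z * (- Li2 (w * exp z) - - Li2 (w * exp 0))
          + (\<Sum>n=1..L. bernpoly n (of_real x) / fact n * (z / of_nat M) ^ (n - 1)
              * ((deriv ^^ (n - 1)) h z - (deriv ^^ (n - 1)) h 0))))
    \<le> K / real M ^ L"
    using euler_maclaurin_holomorphic[OF hol U SU S G x, of L] by blast
  show ?thesis
  proof (intro exI[of _ K] ballI allI impI)
    fix z M assume z: "z \<in> wedge \<delta> C" "z \<noteq> 0" and M: "M \<ge> (1::nat)"
    have zU: "z \<in> U" "0 \<in> U"
      using z SU S by (auto simp: S_def)
    define b where "b n = bernpoly n (of_real x) / fact n * (z / of_nat M) ^ (n - 1)" for n
    have "(\<Sum>n=1..L. b n * ((deriv ^^ (n - 1)) h z - (deriv ^^ (n - 1)) h 0))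
       = b 1 * (h z - h 0) + (\<Sum>n=2..L. b n * ((deriv ^^ (n - 1)) h z - (deriv ^^ (n - 1)) h 0))"
    proof -
      have "{1..L} = insert 1 {2..L}" using L by auto
      then show ?thesis by simp
    qed
    also have "(\<Sum>n=2..L. b n * ((deriv ^^ (n - 1)) h z - (deriv ^^ (n - 1)) h 0))
       = - (\<Sum>n=2..L. b n * (polylog_neg (n - 2) (w * exp z) - polylog_neg (n - 2) w))"
      unfolding sum_negf[symmetric]
    proof (rule sum.cong[OF refl])
      fix n assume n: "n \<in> {2..L}"
      have "(deriv ^^ (n - 1)) h u = - polylog_neg (n - 2) (w * exp u)" if "u \<in> U" for u
        using higher_deriv_Ln_one_minus_exp[of w u "n - 2"] that n
        by (simp add: U_def h_def[abs_def] Suc_diff_Suc numeral_2_eq_2 del: funpow.simps)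
      from this[OF zU(1)] this[OF zU(2)]
      show "b n * ((deriv ^^ (n - 1)) h z - (deriv ^^ (n - 1)) h 0)
         = - (b n * (polylog_neg (n - 2) (w * exp z) - polylog_neg (n - 2) w))"
        by (simp add: algebra_simps)
    qed
    finally have "(\<Sum>n=1..L. b n * ((deriv ^^ (n - 1)) h z - (deriv ^^ (n - 1)) h 0))
       = b 1 * (h z - h 0) - (\<Sum>n=2..L. b n * (polylog_neg (n - 2) (w * exp z) - polylog_neg (n - 2) w))"
      by simp
    moreover have "b 1 = of_real x - 1/2"
      by (simp add: b_def bernpoly_1[simplified])
    moreover have "of_nat M / z * (- Li2 (w * exp z) - - Li2 (w * exp 0))
       = - (of_nat M / z * (Li2 (w * exp z) - Li2 w))"
      by (simp add: algebra_simps diff_divide_distrib)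
    ultimately have "of_nat M / z * (- Li2 (w * exp z) - - Li2 (w * exp 0))
         + (\<Sum>n=1..L. b n * ((deriv ^^ (n - 1)) h z - (deriv ^^ (n - 1)) h 0))
       = - (of_nat M / z * (Li2 (w * exp z) - Li2 w)) + (of_real x - 1/2) * (h z - h 0)
          - (\<Sum>n=2..L. b n * (polylog_neg (n - 2) (w * exp z) - polylog_neg (n - 2) w))"
      by (simp only:) simp
    then show "norm ((\<Sum>m<M. Ln (1 - w * exp ((of_nat m + of_real x) * (z / of_nat M))))
       - (- (of_nat M / z * (Li2 (w * exp z) - Li2 w))
          + (of_real x - 1/2) * (Ln (1 - w * exp z) - Ln (1 - w))
          - (\<Sum>n=2..L. bernpoly n (of_real x) / fact n * (z / of_nat M) ^ (n - 1)
              * (polylog_neg (n - 2) (w * exp z) - polylog_neg (n - 2) w))))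
      \<le> K / real M ^ L"
      using K[rule_format, OF z(1)[folded S_def] M z(2)]
      unfolding b_def[symmetric] by (simp only: h_def exp_zero mult_1_right)
  qed
qed

text \<open>Both arguments lie strictly between -pi/2 and pi/2, so their difference stays inside
  (-pi, pi) and no correction by 2 pi i arises.\<close>

lemma Re_pos_divide:
  assumes "Re a > 0" "Re b > 0"
  shows "a / b \<notin> \<real>\<^sub>\<le>\<^sub>0" "Ln (a / b) = Ln a - Ln b"
proof -
  have nz: "a \<noteq> 0" "b \<noteq> 0" using assms by auto
  show "a / b \<notin> \<real>\<^sub>\<le>\<^sub>0"
  proof
    assume "a / b \<in> \<real>\<^sub>\<le>\<^sub>0"
    then obtain r where r: "a / b = of_real r" "r \<le> 0"
      by (auto elim: nonpos_Reals_cases)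
    then have "a = of_real r * b"
      using nz by (simp add: field_simps)
    then have "Re a = r * Re b" by simp
    with assms r show False
      using mult_nonpos_nonneg[of r "Re b"] by linarith
  qed
  have "Ln (inverse b) = - Ln b"
    using assms by (intro Ln_inverse Re_pos_not_nonpos_Reals)
  moreover have "\<bar>Im (Ln a)\<bar> < pi / 2" "\<bar>Im (Ln b)\<bar> < pi / 2"
    using assms Re_Ln_pos_lt_imp by blast+
  ultimately have "Ln (a * inverse b) = Ln a + Ln (inverse b)"
    using nz by (intro Ln_times_simple) auto
  with \<open>Ln (inverse b) = - Ln b\<close> show "Ln (a / b) = Ln a - Ln b"
    by (simp add: divide_inverse)
qed

section \<open>The regular part log((e^u - 1)/u) of log(1 - e^u)\<close>

definition exp_quot :: "complex \<Rightarrow> complex" where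
  "exp_quot u = (if u = 0 then 1 else (exp u - 1) / u)"

definition ln_exp_quot :: "complex \<Rightarrow> complex" where
  "ln_exp_quot u = Ln (exp_quot u)"

lemma exp_quot_holomorphic: "exp_quot holomorphic_on A"
proof -
  have "(\<lambda>z. if z = 0 then deriv exp 0 else (exp z - exp 0) / (z - 0)) holomorphic_on (UNIV :: complex set)"
    by (rule pole_lemma) (auto intro: holomorphic_intros)
  moreover have "deriv exp (0 :: complex) = 1"
    using DERIV_imp_deriv[OF DERIV_exp[of "0 :: complex"]] by simp
  then have "exp_quot = (\<lambda>z. if z = 0 then deriv exp 0 else (exp z - exp 0) / (z - 0))"
    by (simp add: exp_quot_def fun_eq_iff)
  ultimately have "exp_quot holomorphic_on UNIV"
    by (simp only:)
  then show ?thesis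
    using holomorphic_on_subset by blast
qed

lemma ln_exp_quot_holomorphic: "ln_exp_quot holomorphic_on {u. exp_quot u \<notin> \<real>\<^sub>\<le>\<^sub>0}"
  unfolding ln_exp_quot_def[abs_def]
  by (intro holomorphic_on_Ln' exp_quot_holomorphic) auto

lemma exp_quot_domain_open: "open {u. exp_quot u \<notin> \<real>\<^sub>\<le>\<^sub>0}"
  by (intro nonpos_Reals_complement_vimage_open holomorphic_on_imp_continuous_on exp_quot_holomorphic)

lemma exp_quot_left_half_plane:
  assumes "Re u < 0"
  shows "exp_quot u \<notin> \<real>\<^sub>\<le>\<^sub>0" "ln_exp_quot u = Ln (1 - exp u) - Ln (- u)"
proof -
  have 1: "Re (1 - exp u) > 0"
    using assms by (rule Re_one_minus_exp_pos)
  have 2: "Re (- u) > 0" using assms by simp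
  have "exp_quot u = (1 - exp u) / (- u)"
    using assms by (auto simp: exp_quot_def divide_simps)
  with Re_pos_divide[OF 1 2] show "exp_quot u \<notin> \<real>\<^sub>\<le>\<^sub>0" "ln_exp_quot u = Ln (1 - exp u) - Ln (- u)"
    by (auto simp: ln_exp_quot_def)
qed

lemma higher_deriv_Ln_minus:
  assumes "Re u < 0"
  shows "(deriv ^^ Suc m) (\<lambda>u. Ln (- u)) u = (-1) ^ m * fact m / u ^ Suc m"
  using assms
proof (induction m arbitrary: u)
  case 0
  have "((\<lambda>u. Ln (- u)) has_field_derivative 1 / u) (at u)"
    using 0 by (auto intro!: derivative_eq_intros simp: complex_nonpos_Reals_iff divide_inverse)
  then show ?case by (simp add: DERIV_imp_deriv)
next
  case (Suc m)
  have u: "open {u. Re u < 0}" "u \<in> {u. Re u < 0}" "u \<noteq> 0"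
    using Suc.prems by (auto simp: open_halfspace_Re_lt)
  have "(deriv ^^ Suc (Suc m)) (\<lambda>u. Ln (- u)) u = deriv (\<lambda>u. (-1) ^ m * fact m / u ^ Suc m) u"
    unfolding funpow.simps(2)[of "Suc m"] o_def
    by (rule deriv_cong_ev[OF _ refl], rule eventually_mono[OF eventually_nhds_in_open[OF u(1,2)]])
      (use Suc.IH in auto)
  also have "\<dots> = (-1) ^ Suc m * fact (Suc m) / u ^ Suc (Suc m)"
    using DERIV_cmult[OF DERIV_power_Suc[OF DERIV_inverse[OF u(3)]], of "(-1) ^ m * fact m" m UNIV]
    by (intro DERIV_imp_deriv) (simp add: divide_inverse power_inverse algebra_simps)
  finally show ?case .
qed

text \<open>The pole in u is the contribution of -log(-u). In
  \<open>log_sum_expansion_singular\<close> it is what cancels the Stirling terms.\<close>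

lemma higher_deriv_ln_exp_quot:
  assumes "Re u < 0"
  shows "(deriv ^^ Suc m) ln_exp_quot u = - polylog_neg m (exp u) - (-1) ^ m * fact m / u ^ Suc m"
proof -
  define H where "H = {u :: complex. Re u < 0}"
  have H: "open H" "u \<in> H"
    using assms by (auto simp: H_def open_halfspace_Re_lt)
  have dom: "1 - 1 * exp v \<notin> \<real>\<^sub>\<le>\<^sub>0" if "v \<in> H" for v
    using that Re_one_minus_exp_pos[of v] Re_pos_not_nonpos_Reals by (simp add: H_def)
  have hol: "(\<lambda>v. Ln (1 - 1 * exp v)) holomorphic_on H" "(\<lambda>v. Ln (- v)) holomorphic_on H"
    using dom by (auto intro!: holomorphic_intros simp: complex_nonpos_Reals_iff H_def)
  have "(deriv ^^ Suc m) ln_exp_quot u = (deriv ^^ Suc m) (\<lambda>v. Ln (1 - 1 * exp v) - Ln (- v)) u"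
  proof (rule higher_deriv_transform_within_open[OF _ _ H])
    show "ln_exp_quot holomorphic_on H"
      by (rule holomorphic_on_subset[OF ln_exp_quot_holomorphic])
        (auto simp: H_def exp_quot_left_half_plane)
  qed (use hol in \<open>auto intro!: holomorphic_intros simp: H_def exp_quot_left_half_plane\<close>)
  also have "\<dots> = (deriv ^^ Suc m) (\<lambda>v. Ln (1 - 1 * exp v)) u - (deriv ^^ Suc m) (\<lambda>v. Ln (- v)) u"
    by (rule higher_deriv_diff[OF hol H])
  finally show ?thesis
    using higher_deriv_Ln_one_minus_exp[OF dom[OF H(2)], of m] higher_deriv_Ln_minus[OF assms, of m]
    by simp
qed

text \<open>The odd part of $\log((e^u-1)/u)$ is $u/2$, as $(e^u-1)/u = e^u \cdot (e^{-u}-1)/(-u)$.\<close>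
lemma higher_deriv_ln_exp_quot_0:
  assumes "odd n"
  shows "(deriv ^^ n) ln_exp_quot 0 = (if n = 1 then 1/2 else 0)"
proof -
  \<comment> \<open>V is symmetric under u -> -u, and on it both quotients lie in the right
    half-plane, so their logarithms may be subtracted. Radius 1 < pi ensures Ln (exp u) = u.\<close>
  define V where "V = ball 0 1 \<inter> {u. Re (exp_quot u) > 0} \<inter> {u. Re (exp_quot (- u)) > 0}"
  have cont: "continuous_on A exp_quot" for A
    using exp_quot_holomorphic holomorphic_on_imp_continuous_on by blast
  have V: "open V" "0 \<in> V"
    unfolding V_def
    by (intro open_Int open_ball open_Collect_less continuous_intros continuous_on_compose2[OF cont[of UNIV]])
      (auto simp: exp_quot_def)
  have VV: "- u \<in> V" if "u \<in> V" for u
    using that by (auto simp: V_def)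
  have hol: "ln_exp_quot holomorphic_on V"
    by (rule holomorphic_on_subset[OF ln_exp_quot_holomorphic])
      (auto simp: V_def Re_pos_not_nonpos_Reals)
  have hol': "(\<lambda>u. ln_exp_quot (- 1 * u)) holomorphic_on V"
    by (rule holomorphic_on_compose_gen[where g = ln_exp_quot and t = V and f = "\<lambda>u. - 1 * u", unfolded o_def])
      (use VV hol in \<open>auto intro!: holomorphic_intros\<close>)
  have odd_part: "ln_exp_quot u - ln_exp_quot (- 1 * u) = u" if "u \<in> V" for u
  proof (cases "u = 0")
    case False
    have "ln_exp_quot u - ln_exp_quot (- 1 * u) = Ln (exp_quot u / exp_quot (- u))"
      using that by (simp add: V_def ln_exp_quot_def Re_pos_divide)
    also have "exp_quot u / exp_quot (- u) = exp u"
    proof -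
      have "exp_quot (- u) \<noteq> 0"
        using that by (auto simp: V_def)
      moreover have "exp u * exp_quot (- u) = exp_quot u"
        using False by (simp add: exp_quot_def exp_minus field_simps)
      ultimately show ?thesis by (simp add: field_simps)
    qed
    also have "Ln (exp u) = u"
    proof (rule Ln_exp)
      have "\<bar>Im u\<bar> < 1"
        using abs_Im_le_cmod[of u] that by (auto simp: V_def)
      then show "- pi < Im u" "Im u \<le> pi"
        using pi_gt3 by auto
    qed
    finally show ?thesis .
  qed simp
  have "(deriv ^^ n) (\<lambda>u. ln_exp_quot u - ln_exp_quot (- 1 * u)) 0 = (deriv ^^ n) (\<lambda>u. u) 0"
    by (rule higher_deriv_transform_within_open[OF _ _ V])
      (use hol hol' odd_part in \<open>auto intro!: holomorphic_intros\<close>)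
  moreover have "(deriv ^^ n) (\<lambda>u. ln_exp_quot u - ln_exp_quot (- 1 * u)) 0
     = (deriv ^^ n) ln_exp_quot 0 - (deriv ^^ n) (\<lambda>u. ln_exp_quot (- 1 * u)) 0"
    by (rule higher_deriv_diff[OF hol hol' V])
  moreover have "(deriv ^^ n) (\<lambda>u. ln_exp_quot (- 1 * u)) 0 = (- 1) ^ n * (deriv ^^ n) ln_exp_quot (- 1 * 0)"
    by (rule higher_deriv_compose_linear[OF hol V(1) V(1) V(2)]) (use VV in simp)
  ultimately have "2 * (deriv ^^ n) ln_exp_quot 0 = (if n = 1 then 1 else 0)"
    using assms by (cases "n = 0"; cases "n = 1"; simp)
  then show ?thesis
    by (auto simp: field_simps split: if_splits)
qed

text \<open>This makes the primitive u log(-u) - u continuous at the apex of the wedge. The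
  imaginary part of Ln is bounded by pi, so the claim reduces to x (|ln x| + pi) -> 0.\<close>

lemma tendsto_mult_Ln_minus_0: "((\<lambda>u. u * Ln (- u)) \<longlongrightarrow> 0) (at 0 within S)"
proof (rule Lim_null_comparison)
  have *: "filterlim (norm :: complex \<Rightarrow> real) (at_right 0) (at 0 within S)"
    by (auto simp: filterlim_at eventually_at_filter intro!: tendsto_eq_intros)
  have "((\<lambda>x::real. x * (\<bar>ln x\<bar> + pi)) \<longlongrightarrow> 0) (at_right 0)"
    by real_asymp
  from filterlim_compose[OF this *]
  show "((\<lambda>u. norm u * (\<bar>ln (norm u)\<bar> + pi)) \<longlongrightarrow> 0) (at 0 within S)" .
  show "\<forall>\<^sub>F u in at 0 within S. norm (u * Ln (- u)) \<le> norm u * (\<bar>ln (norm u)\<bar> + pi)"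
  proof (rule eventually_at_filter[THEN iffD2, OF always_eventually], intro allI impI)
    fix u :: complex assume "u \<noteq> 0"
    then have "\<bar>Im (Ln (- u))\<bar> \<le> pi" "Re (Ln (- u)) = ln (norm u)"
      using mpi_less_Im_Ln[of "- u"] Im_Ln_le_pi[of "- u"] by auto
    then have "norm (Ln (- u)) \<le> \<bar>ln (norm u)\<bar> + pi"
      using cmod_le[of "Ln (- u)"] by simp
    then show "norm (u * Ln (- u)) \<le> norm u * (\<bar>ln (norm u)\<bar> + pi)"
      by (simp add: norm_mult mult_left_mono)
  qed
qed

text \<open>At u = (m+1) z/M the singular part log(-u) sums to log M! - M log M + M log(-z), which
  Stirling's series expands; the regular part is handled by Euler-Maclaurin with x = 1. Everything
  singular in z cancels between the two.\<close>

lemma log_sum_expansion_singular: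
  assumes \<delta>: "\<delta> > 0" "C > 0" and L: "L \<ge> 1"
  shows "\<exists>K. \<forall>z\<in>wedge \<delta> C. \<forall>M\<ge>1. z \<noteq> 0 \<longrightarrow>
    norm ((\<Sum>m<M. Ln (1 - exp ((of_nat m + 1) * (z / of_nat M))))
       - (- (of_nat M / z * (Li2 (exp z) - Li2 1))
          + (Ln (of_nat M) + of_real (ln (2 * pi)) + ln_exp_quot z) / 2
          - (\<Sum>n=2..L. bernpoly n 1 / fact n * (z / of_nat M) ^ (n - 1)
              * (polylog_neg (n - 2) (exp z) + (if n = 2 then 1/2 else 0)))))
    \<le> K / real M ^ L"
proof -
  define S where "S = wedge \<delta> C"
  define U where "U = {u. exp_quot u \<notin> \<real>\<^sub>\<le>\<^sub>0}"
  have Re_neg: "Re u < 0" if "u \<in> S - {0}" for u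
    using wedge_Re_neg[of u \<delta> C] that \<delta> by (auto simp: S_def)
  have Re_le: "Re u \<le> 0" if "u \<in> S" for u
    using Re_neg[of u] that by (cases "u = 0") auto
  have U: "open U"
    unfolding U_def by (rule exp_quot_domain_open)
  have hol: "ln_exp_quot holomorphic_on U"
    unfolding U_def by (rule ln_exp_quot_holomorphic)
  have SU: "S \<subseteq> U"
  proof
    fix u assume "u \<in> S"
    then show "u \<in> U"
      using Re_neg[of u] exp_quot_left_half_plane(1)[of u]
      by (cases "u = 0") (auto simp: U_def exp_quot_def)
  qed
  have S: "convex S" "compact S" "0 \<in> S"
    using convex_wedge compact_wedge zero_in_wedge \<delta> by (auto simp: S_def)
  \<comment> \<open>The primitive -Li_2(e^u) of log(1 - e^u) minus the primitive u log(-u) - u of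
    log(-u).\<close>
  define G where "G u = - Li2 (1 * exp u) - (u * Ln (- u) - u)" for u
  have G: "(G has_field_derivative ln_exp_quot u) (at u within S)" if "u \<in> S" for u
  proof (rule primitive_extends_across_finite_set[OF S(1), of "{0}"])
    show "continuous_on S ln_exp_quot"
      using hol SU holomorphic_on_imp_continuous_on holomorphic_on_subset by blast
    show "ln_exp_quot field_differentiable at u" if "u \<in> interior S - {0}" for u
      using hol U SU that interior_subset holomorphic_on_imp_differentiable_at by blast
    have "continuous_on S (\<lambda>u. u * Ln (- u))"
      unfolding continuous_on_eq_continuous_within
    proof
      fix u assume u: "u \<in> S"
      show "continuous (at u within S) (\<lambda>u. u * Ln (- u))"
      proof (cases "u = 0")
        case True
        then show ?thesis
          using tendsto_mult_Ln_minus_0[of S] by (simp add: continuous_within)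
      next
        case False
        then have "- u \<notin> \<real>\<^sub>\<le>\<^sub>0"
          using Re_neg[of u] u by (simp add: complex_nonpos_Reals_iff)
        then show ?thesis
          by (rule continuous_at_imp_continuous_at_within[OF continuous_mult[OF continuous_ident
                isCont_Ln'[OF continuous_minus[OF continuous_ident]]]])
      qed
    qed
    then show "continuous_on S G"
      unfolding G_def by (intro continuous_on_diff continuous_on_minus continuous_on_Li2_exp continuous_on_id' Re_le) auto
    show "(G has_field_derivative ln_exp_quot u) (at u within S)" if "u \<in> S - {0}" for u
    proof -
      have u: "Re u < 0" "- u \<notin> \<real>\<^sub>\<le>\<^sub>0" "u \<noteq> 0"
        using Re_neg[OF that] by (auto simp: complex_nonpos_Reals_iff)
      have "((\<lambda>u. u * Ln (- u) - u) has_field_derivative Ln (- u)) (at u within S)"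
        using u by (auto intro!: derivative_eq_intros)
      from DERIV_diff[OF DERIV_minus[OF Li2_exp_has_derivative[of 1 u S]] this]
      show ?thesis
        using u by (simp add: G_def[abs_def] exp_quot_left_half_plane)
    qed
  qed (use that in auto)
  obtain K1 where K1: "\<forall>z\<in>S. \<forall>M\<ge>1. z \<noteq> 0 \<longrightarrow>
    norm ((\<Sum>m<M. ln_exp_quot ((of_nat m + of_real 1) * (z / of_nat M)))
       - (of_nat M / z * (G z - G 0)
          + (\<Sum>n=1..L. bernpoly n (of_real 1) / fact n * (z / of_nat M) ^ (n - 1)
              * ((deriv ^^ (n - 1)) ln_exp_quot z - (deriv ^^ (n - 1)) ln_exp_quot 0))))
    \<le> K1 / real M ^ L"
    using euler_maclaurin_holomorphic[OF hol U SU S G, of 1 L] by auto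
  obtain K2 where K2: "\<forall>M\<ge>1. norm ((\<Sum>j<M. Ln (of_nat (Suc j)))
     - (of_nat M * Ln (of_nat M) - of_nat M + Ln (of_nat M) / 2 + of_real (ln (2 * pi)) / 2
        + (\<Sum>n=2..L. bernpoly n 1 / fact n * ((-1) ^ n * fact (n - 2) / of_nat M ^ (n - 1)))))
     \<le> K2 / real M ^ L"
    using stirling_expansion[OF L] by blast
  show ?thesis
  proof (intro exI[of _ "K1 + K2"] ballI allI impI)
    fix z M assume "z \<in> wedge \<delta> C" and z0: "z \<noteq> 0" and M: "M \<ge> (1::nat)"
    then have z: "z \<in> S" by (simp add: S_def)
    have Rez: "Re z < 0" using Re_neg[of z] z z0 by simp
    define b where "b n = bernpoly n 1 / fact n" for n
    define \<epsilon> where "\<epsilon> = z / of_nat M"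
    define \<phi> where "\<phi> n = (deriv ^^ n) ln_exp_quot" for n
    define P where "P = (\<Sum>n=2..L. b n * ((-1) ^ n * fact (n - 2) / of_nat M ^ (n - 1)))"
    define Q where "Q = (\<Sum>n=2..L. b n * \<epsilon> ^ (n - 1) * (\<phi> (n - 1) z - \<phi> (n - 1) 0))"
    define R where "R = (\<Sum>n=2..L. b n * \<epsilon> ^ (n - 1)
              * (polylog_neg (n - 2) (exp z) + (if n = 2 then 1/2 else 0)))"
    \<comment> \<open>The Stirling terms P cancel the poles in the derivatives at z, since
      \<epsilon>^(n-1) / z^(n-1) = M^(1-n). Only polylogarithms and one constant at n = 2
      remain.\<close>
    have PQ: "P + Q = - R"
      unfolding P_def Q_def R_def sum.distrib[symmetric] sum_negf[symmetric]
    proof (rule sum.cong[OF refl])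
      fix n assume "n \<in> {2..L}"
      then obtain i where i: "n = Suc (Suc i)"
        by (metis atLeastAtMost_iff add_2_eq_Suc le_Suc_ex)
      have "\<phi> (n - 1) z = - polylog_neg i (exp z) - (-1) ^ i * fact i / z ^ Suc i"
        using higher_deriv_ln_exp_quot[OF Rez, of i] by (simp add: \<phi>_def i del: funpow.simps)
      \<comment> \<open>For even n the derivative has odd order n - 1, known from
        \<open>higher_deriv_ln_exp_quot_0\<close>; for odd n >= 3 the factor B_n(1) vanishes. So the
        even-order derivatives at 0 need not be computed.\<close>
      moreover have "b n * \<phi> (n - 1) 0 = b n * (if n = 2 then 1/2 else 0)"
      proof (cases "even n")
        case True
        then show ?thesis
          using higher_deriv_ln_exp_quot_0[of "n - 1"] by (auto simp: \<phi>_def i)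
      next
        case False
        then show ?thesis
          using bernpoly_1_odd[of n] by (auto simp: b_def i)
      qed
      then have "b n * \<epsilon> ^ (n - 1) * \<phi> (n - 1) 0 = b n * \<epsilon> ^ (n - 1) * (if n = 2 then 1/2 else 0)"
        by (metis mult.commute mult.left_commute)
      moreover have "b n * ((-1) ^ n * fact (n - 2) / of_nat M ^ (n - 1))
          = b n * \<epsilon> ^ (n - 1) * ((-1) ^ i * fact i / z ^ Suc i)"
        using z0 M by (simp add: i \<epsilon>_def power_divide)
      ultimately show "b n * ((-1) ^ n * fact (n - 2) / of_nat M ^ (n - 1))
           + b n * \<epsilon> ^ (n - 1) * (\<phi> (n - 1) z - \<phi> (n - 1) 0)
         = - (b n * \<epsilon> ^ (n - 1) * (polylog_neg (n - 2) (exp z) + (if n = 2 then 1/2 else 0)))"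
        by (simp only: right_diff_distrib distrib_left) (simp add: i)
    qed
    have "(\<Sum>n=1..L. b n * \<epsilon> ^ (n - 1) * (\<phi> (n - 1) z - \<phi> (n - 1) 0)) = ln_exp_quot z / 2 + Q"
    proof -
      have "{1..L} = insert 1 {2..L}" using L by auto
      moreover have "b 1 = 1/2" using bernpoly_1[of 1] by (simp add: b_def)
      moreover have "\<phi> 0 z = ln_exp_quot z" "\<phi> 0 0 = 0"
        by (auto simp: \<phi>_def ln_exp_quot_def exp_quot_def)
      ultimately show ?thesis by (simp add: Q_def)
    qed
    then have N1: "norm ((\<Sum>m<M. ln_exp_quot ((of_nat m + 1) * \<epsilon>))
       - (of_nat M / z * (G z - G 0) + (ln_exp_quot z / 2 + Q))) \<le> K1 / real M ^ L"
      using K1[rule_format, OF z M z0] by (simp add: b_def \<epsilon>_def \<phi>_def)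
    have N2: "norm ((\<Sum>j<M. Ln (of_nat (Suc j)))
     - (of_nat M * Ln (of_nat M) - of_nat M + Ln (of_nat M) / 2 + of_real (ln (2 * pi)) / 2 + P)) \<le> K2 / real M ^ L"
      using K2[rule_format, OF M] by (simp only: b_def P_def)
    have "(\<Sum>m<M. Ln (1 - exp ((of_nat m + 1) * \<epsilon>)))
       = (\<Sum>m<M. ln_exp_quot ((of_nat m + 1) * \<epsilon>) + (Ln (of_nat (Suc m)) - Ln (of_nat M) + Ln (- z)))"
    proof (rule sum.cong[OF refl])
      fix m
      \<comment> \<open>The points are positive real multiples of z, so the logarithm of the factor
        (m+1)/M splits off without changing the branch of Ln (- z).\<close>
      define r where "r = real (Suc m) / real M"
      have r: "r > 0" using M by (simp add: r_def)
      have eq: "(of_nat m + 1) * \<epsilon> = of_real r * z"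
        by (simp add: r_def \<epsilon>_def add.commute)
      have "Re (of_real r * z) < 0"
        using r Rez by (simp add: mult_pos_neg)
      then have "Ln (1 - exp (of_real r * z)) = ln_exp_quot (of_real r * z) + Ln (- (of_real r * z))"
        using exp_quot_left_half_plane(2) by simp
      also have "- (of_real r * z) = of_real r * (- z)" by simp
      also have "Ln \<dots> = of_real (ln r) + Ln (- z)"
        using r z0 by (subst Ln_times_of_real) (auto simp: Ln_of_real)
      also have "ln r = ln (real (Suc m)) - ln (real M)"
        unfolding r_def using M by (simp add: ln_div)
      also have "of_real \<dots> = Ln (of_nat (Suc m)) - Ln (of_nat M)"
        using Ln_of_real[of "real (Suc m)"] Ln_of_real[of "real M"] M by simp
      finally show "Ln (1 - exp ((of_nat m + 1) * \<epsilon>))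
        = ln_exp_quot ((of_nat m + 1) * \<epsilon>) + (Ln (of_nat (Suc m)) - Ln (of_nat M) + Ln (- z))"
        unfolding eq by simp
    qed
    also have "\<dots> = (\<Sum>m<M. ln_exp_quot ((of_nat m + 1) * \<epsilon>))
        + ((\<Sum>j<M. Ln (of_nat (Suc j))) - of_nat M * Ln (of_nat M) + of_nat M * Ln (- z))"
      by (simp only: sum.distrib sum_subtractf sum_constant card_lessThan)
    \<comment> \<open>The term - M Ln (- z) offsets + M Ln (- z) in the sum of logarithms, and + M
      offsets the - M of Stirling's formula.\<close>
    moreover have "of_nat M / z * (G z - G 0)
       = - (of_nat M / z * (Li2 (exp z) - Li2 1)) - of_nat M * Ln (- z) + of_nat M"
      using z0 by (simp add: G_def field_simps)
    ultimately have "(\<Sum>m<M. Ln (1 - exp ((of_nat m + 1) * \<epsilon>)))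
       - (- (of_nat M / z * (Li2 (exp z) - Li2 1))
          + (Ln (of_nat M) + of_real (ln (2 * pi)) + ln_exp_quot z) / 2 - R)
     = ((\<Sum>m<M. ln_exp_quot ((of_nat m + 1) * \<epsilon>))
         - (of_nat M / z * (G z - G 0) + (ln_exp_quot z / 2 + Q)))
       + ((\<Sum>j<M. Ln (of_nat (Suc j)))
         - (of_nat M * Ln (of_nat M) - of_nat M + Ln (of_nat M) / 2 + of_real (ln (2 * pi)) / 2 + P))
       + (P + Q + R)"
      by (simp only: add_divide_distrib) (simp add: algebra_simps)
    also have "P + Q + R = 0"
      by (simp add: PQ)
    finally have "norm ((\<Sum>m<M. Ln (1 - exp ((of_nat m + 1) * \<epsilon>)))
       - (- (of_nat M / z * (Li2 (exp z) - Li2 1))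
          + (Ln (of_nat M) + of_real (ln (2 * pi)) + ln_exp_quot z) / 2 - R))
       \<le> K1 / real M ^ L + K2 / real M ^ L"
      using norm_triangle_mono[OF N1 N2] by (simp only: add_0_right)
    then show "norm ((\<Sum>m<M. Ln (1 - exp ((of_nat m + 1) * (z / of_nat M))))
       - (- (of_nat M / z * (Li2 (exp z) - Li2 1))
          + (Ln (of_nat M) + of_real (ln (2 * pi)) + ln_exp_quot z) / 2
          - (\<Sum>n=2..L. bernpoly n 1 / fact n * (z / of_nat M) ^ (n - 1)
              * (polylog_neg (n - 2) (exp z) + (if n = 2 then 1/2 else 0)))))
      \<le> (K1 + K2) / real M ^ L"
      unfolding b_def \<epsilon>_def R_def by (simp only: add_divide_distrib)
  qed
qed

section \<open>Assembling the residue classes\<close>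

lemma inverse_power_root_of_unity:
  fixes \<rho> :: complex
  assumes "\<rho> ^ k = 1" "j \<le> k"
  shows "inverse \<rho> ^ j = \<rho> ^ (k - j)"
proof -
  have "\<rho> ^ (k - j) * \<rho> ^ j = 1"
    using assms by (simp flip: power_add)
  then show ?thesis
    by (metis inverse_unique mult.commute power_inverse)
qed

text \<open>Under j -> k - j the sign (-1)^(l+1) is absorbed by the reflection of B_(l+1), and
  \<rho>^(-j) becomes \<rho>^r. The isolated 1/12 is B_2(1) = 1/6 times the 1/2 produced by the
  singular class.\<close>

lemma ffun_reflect:
  assumes \<rho>: "\<rho> ^ k = 1" and k: "k \<ge> 1" and l: "l \<ge> 1"
  shows "ffun k \<rho> l z = (of_nat k * z) ^ l / fact (l + 1)
     * (bernpoly (l + 1) 1 * (polylog_neg (l - 1) (exp z) + (if l = 1 then 1/2 else 0))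
        + (\<Sum>r=1..k-1. bernpoly (l + 1) (of_nat r / of_nat k)
             * (polylog_neg (l - 1) (\<rho> ^ r * exp z) - polylog_neg (l - 1) (\<rho> ^ r))))"
proof -
  have "(-1) ^ (l + 1) * (\<Sum>j=1..k-1. bernpoly (l + 1) (of_nat j / of_nat k)
         * (polylog_neg (l - 1) (inverse \<rho> ^ j * exp z) - polylog_neg (l - 1) (inverse \<rho> ^ j)))
     = (\<Sum>r=1..k-1. bernpoly (l + 1) (of_nat r / of_nat k)
         * (polylog_neg (l - 1) (\<rho> ^ r * exp z) - polylog_neg (l - 1) (\<rho> ^ r)))"
    unfolding sum_distrib_left
  proof (rule sum.reindex_bij_witness[where i = "\<lambda>r. k - r" and j = "\<lambda>r. k - r"])
    fix j assume j: "j \<in> {1..k-1}"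
    have "j \<le> k" "k \<noteq> 0"
      using j by auto
    then have "of_nat (k - j) / of_nat k = 1 - of_nat j / (of_nat k :: complex)"
      by (simp add: of_nat_diff diff_divide_distrib)
    then have "bernpoly (l + 1) (of_nat (k - j) / of_nat k) = (-1) ^ (l + 1) * bernpoly (l + 1) (of_nat j / of_nat k)"
      by (simp only: bernpoly_reflect)
    moreover have "inverse \<rho> ^ j = \<rho> ^ (k - j)"
      using j by (intro inverse_power_root_of_unity \<rho>) auto
    ultimately show "bernpoly (l + 1) (of_nat (k - j) / of_nat k)
         * (polylog_neg (l - 1) (\<rho> ^ (k - j) * exp z) - polylog_neg (l - 1) (\<rho> ^ (k - j)))
       = (-1) ^ (l + 1) * (bernpoly (l + 1) (of_nat j / of_nat k)
         * (polylog_neg (l - 1) (inverse \<rho> ^ j * exp z) - polylog_neg (l - 1) (inverse \<rho> ^ j)))"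
      by (simp only: mult.assoc)
  qed (use k in auto)
  moreover have "(-1) ^ (l + 1) * bernpoly (l + 1) 0 = bernpoly (l + 1) 1"
    using bernpoly_reflect[of "l + 1" 0] by simp
  moreover have "(-1) ^ (l + 1) * (if l = 1 then 1/12 else 0) = bernpoly (l + 1) 1 * (if l = 1 then 1/2 else 0)"
    using bernpoly_2_1 by (simp add: numeral_2_eq_2)
  moreover have "ffun k \<rho> l z = (of_nat k * z) ^ l / fact (l + 1)
     * ((-1) ^ (l + 1) * (if l = 1 then 1/12 else 0)
        + ((-1) ^ (l + 1) * bernpoly (l + 1) 0) * polylog_neg (l - 1) (exp z)
        + (-1) ^ (l + 1) * (\<Sum>j=1..k-1. bernpoly (l + 1) (of_nat j / of_nat k)
         * (polylog_neg (l - 1) (inverse \<rho> ^ j * exp z) - polylog_neg (l - 1) (inverse \<rho> ^ j))))"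
    unfolding ffun_def by (simp only: distrib_left times_divide_eq_right times_divide_eq_left mult_ac)
  ultimately show ?thesis
    by (simp only: distrib_left add_ac)
qed

text \<open>The exponent j/k - 1/2 changes sign under j -> k - j, which supplies the minus sign of
  the reciprocal product. Numerators and denominators lie in the right half-plane, so each principal
  power is the exponential of a difference of logarithms.\<close>

lemma gfun_eq_exp:
  assumes \<rho>: "\<rho> ^ k = 1" "\<forall>m. 0 < m \<and> m < k \<longrightarrow> \<rho> ^ m \<noteq> 1" and k: "k \<ge> 1" and z: "Re z < 0"
  shows "gfun k \<rho> z = exp (- ((of_real (ln (2 * pi)) + ln_exp_quot z) / 2)
     - (\<Sum>r=1..k-1. (of_nat r / of_nat k - 1/2) * (Ln (1 - \<rho> ^ r * exp z) - Ln (1 - \<rho> ^ r))))"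
proof -
  have n\<rho>: "norm (\<rho> ^ r) = 1" for r
    using norm_root_of_unity[OF \<rho>(1) k] by (simp add: norm_power)
  have 1: "(- z / (2 * of_real pi * (1 - exp z))) powr (1/2) = exp (- ((of_real (ln (2 * pi)) + ln_exp_quot z) / 2))"
  proof -
    have Re1: "Re (1 - exp z) > 0" "Re (- z) > 0"
      using z Re_one_minus_exp_pos by auto
    have nz: "- z / (1 - exp z) \<noteq> 0"
      using Re1 by auto
    have eq: "- z / (2 * of_real pi * (1 - exp z)) = (- z / (1 - exp z)) / of_real (2 * pi)"
      by simp
    have "Ln (- z / (2 * of_real pi * (1 - exp z))) = (Ln (- z) - Ln (1 - exp z)) - of_real (ln (2 * pi))"
      unfolding eq using Ln_divide_of_real[OF _ nz, of "2 * pi"] Re_pos_divide(2)[OF Re1(2,1)] by simp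
    also have "\<dots> = - (of_real (ln (2 * pi)) + ln_exp_quot z)"
      using exp_quot_left_half_plane(2)[OF z] by simp
    finally show ?thesis
      using nz by (simp add: powr_def add_divide_distrib diff_divide_distrib)
  qed
  have "(\<Prod>j=1..k-1. ((1 - inverse \<rho> ^ j * exp z) / (1 - inverse \<rho> ^ j)) powr (of_nat j / of_nat k - 1/2))
     = (\<Prod>r=1..k-1. exp (- ((of_nat r / of_nat k - 1/2) * (Ln (1 - \<rho> ^ r * exp z) - Ln (1 - \<rho> ^ r)))))"
  proof (rule prod.reindex_bij_witness[where i = "\<lambda>r. k - r" and j = "\<lambda>r. k - r"])
    fix j assume j: "j \<in> {1..k-1}"
    have inv: "inverse \<rho> ^ j = \<rho> ^ (k - j)"
      using j by (intro inverse_power_root_of_unity \<rho>) auto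
    have ne: "\<rho> ^ (k - j) \<noteq> 1"
      using \<rho>(2) j k by auto
    have "norm (\<rho> ^ (k - j) * exp z) < 1"
      using z by (simp add: norm_mult n\<rho>)
    then have Re1: "Re (1 - \<rho> ^ (k - j) * exp z) > 0"
      by (intro Re_one_minus_pos) auto
    have Re2: "Re (1 - \<rho> ^ (k - j)) > 0"
      using ne by (intro Re_one_minus_pos) (simp_all only: n\<rho>, simp)
    have nz: "(1 - \<rho> ^ (k - j) * exp z) / (1 - \<rho> ^ (k - j)) \<noteq> 0"
      using Re1 Re2 by (metis divide_eq_0_iff less_irrefl zero_complex.sel(1))
    have "j \<le> k" "k \<noteq> 0"
      using j by auto
    then have e: "of_nat (k - j) / of_nat k - 1/2 = - (of_nat j / of_nat k - 1/2 :: complex)"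
      by (simp add: of_nat_diff diff_divide_distrib)
    show "exp (- ((of_nat (k - j) / of_nat k - 1/2) * (Ln (1 - \<rho> ^ (k - j) * exp z) - Ln (1 - \<rho> ^ (k - j)))))
       = ((1 - inverse \<rho> ^ j * exp z) / (1 - inverse \<rho> ^ j)) powr (of_nat j / of_nat k - 1/2)"
      unfolding inv e powr_def if_not_P[OF nz] Re_pos_divide(2)[OF Re1 Re2]
      by (simp only: mult_minus_left minus_minus)
  qed (use k in auto)
  also have "\<dots> = exp (\<Sum>r=1..k-1. - ((of_nat r / of_nat k - 1/2) * (Ln (1 - \<rho> ^ r * exp z) - Ln (1 - \<rho> ^ r))))"
    by (rule exp_sum[symmetric]) simp
  finally show ?thesis
    unfolding gfun_def 1 by (simp only: exp_add[symmetric] diff_conv_add_uminus sum_negf)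
qed

text \<open>Only nonvanishing of the factors is needed, and it follows from |\<rho>^j e^(jz/N)| < 1;
  exponentiating the sum makes the choice of branches irrelevant here.\<close>

lemma qpoch_rho_eq_exp:
  assumes \<rho>: "\<rho> ^ k = 1" and k: "k \<ge> 1" and z: "Re z < 0" and M: "M \<ge> 1"
  shows "qpoch_rho \<rho> z (k * M)
    = exp (\<Sum>r=1..k. \<Sum>m<M. Ln (1 - \<rho> ^ r * exp ((of_nat m + of_nat r / of_nat k) * (z / of_nat M))))"
proof -
  define t where "t j = 1 - \<rho> ^ j * exp (of_nat j * z / of_nat (k * M))" for j
  have "qpoch_rho \<rho> z (k * M) = (\<Prod>j=1..k * M. t j)"
    by (simp add: qpoch_rho_def t_def)
  \<comment> \<open>Residues run through 1..k and not 0..k-1, hence the division of j - 1. The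
    singular class, which ends at j = N, is then r = k with x = 1.\<close>
  also have "\<dots> = (\<Prod>(r, m)\<in>{1..k} \<times> {..<M}. t (k * m + r))"
  proof (rule prod.reindex_bij_witness[where i = "\<lambda>(r, m). k * m + r" and j = "\<lambda>j. ((j - 1) mod k + 1, (j - 1) div k)"])
    fix j assume j: "j \<in> {1..k * M}"
    have div: "k * ((j - 1) div k) + (j - 1) mod k = j - 1"
      by simp
    show "(case ((j - 1) mod k + 1, (j - 1) div k) of (r, m) \<Rightarrow> k * m + r) = j"
      using div j by auto
    then show "(case ((j - 1) mod k + 1, (j - 1) div k) of (r, m) \<Rightarrow> t (k * m + r)) = t j"
      by simp
    have "(j - 1) div k < M"
      using j k by (intro less_mult_imp_div_less) (auto simp: mult.commute)
    moreover have "(j - 1) mod k < k" using k by simp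
    ultimately show "((j - 1) mod k + 1, (j - 1) div k) \<in> {1..k} \<times> {..<M}"
      by auto
  next
    fix p assume "p \<in> {1..k} \<times> {..<M}"
    then obtain r m where p: "p = (r, m)" "1 \<le> r" "r \<le> k" "m < M" by auto
    obtain s where "r = Suc s" using p by (cases r) auto
    then show "(((case p of (r, m) \<Rightarrow> k * m + r) - 1) mod k + 1, ((case p of (r, m) \<Rightarrow> k * m + r) - 1) div k) = p"
      using p by simp
    have "k * m + r \<le> k * m + k" using p by simp
    also have "\<dots> = k * Suc m" by simp
    also have "\<dots> \<le> k * M" using p by (intro mult_le_mono) auto
    finally show "(case p of (r, m) \<Rightarrow> k * m + r) \<in> {1..k * M}"
      using p by auto
  qed
  also have "\<dots> = (\<Prod>(r, m)\<in>{1..k} \<times> {..<M}.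
      exp (Ln (1 - \<rho> ^ r * exp ((of_nat m + of_nat r / of_nat k) * (z / of_nat M)))))"
  proof (rule prod.cong[OF refl])
    fix p assume "p \<in> {1..k} \<times> {..<M}"
    then obtain r m where p: "p = (r, m)" and r: "r \<in> {1..k}" and m: "m \<in> {..<M}"
      by auto
    define v where "v = \<rho> ^ r * exp ((of_nat m + of_nat r / of_nat k) * (z / of_nat M))"
    have "Re ((of_nat m + of_nat r / of_nat k) * (z / of_nat M)) = (real m + real r / real k) / real M * Re z"
      by (simp add: Re_divide_of_nat field_simps)
    also have "\<dots> < 0"
      using r k M z by (intro mult_pos_neg divide_pos_pos add_nonneg_pos) auto
    finally have "norm v < 1"
      using norm_root_of_unity[OF \<rho> k] by (simp add: v_def norm_mult norm_power)
    then have "1 - v \<noteq> 0" by auto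
    moreover have "t (k * m + r) = 1 - v"
    proof -
      have "of_nat (k * m + r) * z / of_nat (k * M) = (of_nat m + of_nat r / of_nat k) * (z / of_nat M)"
        using k M by (simp add: field_simps)
      then show ?thesis
        by (simp only: t_def v_def) (simp add: power_add power_mult \<rho>)
    qed
    ultimately show "(case p of (r, m) \<Rightarrow> t (k * m + r)) = (case p of (r, m) \<Rightarrow>
        exp (Ln (1 - \<rho> ^ r * exp ((of_nat m + of_nat r / of_nat k) * (z / of_nat M)))))"
      by (simp add: v_def p)
  qed
  also have "\<dots> = exp (\<Sum>(r, m)\<in>{1..k} \<times> {..<M}. Ln (1 - \<rho> ^ r * exp ((of_nat m + of_nat r / of_nat k) * (z / of_nat M))))"
    by (subst exp_sum) (auto simp: case_prod_unfold)
  finally show ?thesis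
    by (simp only: sum.cartesian_product)
qed

lemma qpoch_rho_expansion_fixed_root:
  assumes \<rho>: "\<rho> ^ k = 1" "\<forall>m. 0 < m \<and> m < k \<longrightarrow> \<rho> ^ m \<noteq> 1"
    and k: "k \<ge> 1" and L: "L \<ge> 1" and \<delta>: "\<delta> > 0" "C > 0"
  shows "\<exists>K. \<forall>N z. N \<ge> 1 \<and> k dvd N \<and> Re z \<le> - \<delta> \<and> norm z \<le> C \<longrightarrow>
           (\<exists>E :: complex. norm E \<le> K / real N ^ L \<and>
              1 / qpoch_rho \<rho> z N =
                (of_nat k / of_nat N) powr (1/2) * gfun k \<rho> z
                * exp (of_nat N / of_nat k * pfun (of_nat k * z)
                       + (\<Sum>l=1..L-1. ffun k \<rho> l z / of_nat N ^ l) + E))"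
proof -
  define T where "T r z M = (\<Sum>m<M. Ln (1 - \<rho> ^ r * exp ((of_nat m + of_nat r / of_nat k) * (z / of_nat M))))"
    for r M :: nat and z
  \<comment> \<open>The case distinctions in \<open>c\<close> and \<open>d\<close> give the regular
    and singular expansions one common shape \<open>A\<close>, so that they can be summed over all
    r.\<close>
  define c where "c r z M = (if r = k then (Ln (of_nat M) + of_real (ln (2 * pi)) + ln_exp_quot z) / 2
     else (of_nat r / of_nat k - 1/2) * (Ln (1 - \<rho> ^ r * exp z) - Ln (1 - \<rho> ^ r)))" for r M :: nat and z
  define d where "d r n z = bernpoly n (of_nat r / of_nat k) * (if r = k
      then polylog_neg (n - 2) (exp z) + (if n = 2 then 1/2 else 0)
      else polylog_neg (n - 2) (\<rho> ^ r * exp z) - polylog_neg (n - 2) (\<rho> ^ r))" for r n z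
  define A where "A r z M = - (of_nat M / z * (Li2 (\<rho> ^ r * exp z) - Li2 (\<rho> ^ r))) + c r z M
     - (\<Sum>n=2..L. (z / of_nat M) ^ (n - 1) / fact n * d r n z)" for r M :: nat and z
  have "\<exists>K. \<forall>z\<in>wedge \<delta> C. \<forall>M\<ge>1. z \<noteq> 0 \<longrightarrow> norm (T r z M - A r z M) \<le> K / real M ^ L"
    if r: "r \<in> {1..k}" for r
  proof (cases "r = k")
    case True
    with log_sum_expansion_singular[OF \<delta> L] show ?thesis
      using \<rho>(1) k by (simp add: T_def A_def c_def d_def mult_ac)
  next
    case False
    then have "\<rho> ^ r \<noteq> 1"
      using \<rho>(2) r by auto
    moreover have "norm (\<rho> ^ r) = 1"
      using norm_root_of_unity[OF \<rho>(1) k] by (simp add: norm_power)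
    ultimately show ?thesis
      using log_sum_expansion_regular[of "\<rho> ^ r" "real r / real k" \<delta> C L] False r k \<delta> L
      by (simp add: T_def A_def c_def d_def mult_ac)
  qed
  then obtain K where K: "\<And>r z M. r \<in> {1..k} \<Longrightarrow> z \<in> wedge \<delta> C \<Longrightarrow> M \<ge> 1 \<Longrightarrow> z \<noteq> 0 \<Longrightarrow>
      norm (T r z M - A r z M) \<le> K r / real M ^ L"
    by metis
  show ?thesis
  proof (intro exI[of _ "(\<Sum>r=1..k. K r) * real k ^ L"] allI impI, elim conjE)
    fix N :: nat and z assume N: "N \<ge> 1" "k dvd N" and z: "Re z \<le> - \<delta>" "norm z \<le> C"
    from N(2) obtain M where NM: "N = k * M" by (auto simp: dvd_def)
    have M: "M \<ge> 1" using N NM by (cases M) auto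
    have Rez: "Re z < 0" "z \<noteq> 0" using z \<delta> by auto
    have zW: "z \<in> wedge \<delta> C" by (intro in_wedgeI z \<delta>)
    have split: "{1..k} = insert k {1..k-1}" using k by auto
    define E where "E = - (\<Sum>r=1..k. T r z M - A r z M)"
    have "norm E \<le> (\<Sum>r=1..k. K r / real M ^ L)"
      unfolding E_def norm_minus_cancel
      by (rule order_trans[OF norm_sum sum_mono]) (use K zW M Rez in auto)
    \<comment> \<open>Since M = N/k, passing from powers of M to powers of N costs the factor
      k^L.\<close>
    also have "\<dots> = (\<Sum>r=1..k. K r) * real k ^ L / real N ^ L"
      using k by (simp add: NM power_mult_distrib sum_divide_distrib)
    finally have E: "norm E \<le> (\<Sum>r=1..k. K r) * real k ^ L / real N ^ L" .

    define F where "F = (\<Sum>r=1..k-1. (of_nat r / of_nat k - 1/2) * (Ln (1 - \<rho> ^ r * exp z) - Ln (1 - \<rho> ^ r)))"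
    have c: "(\<Sum>r=1..k. c r z M) = Ln (of_nat M) / 2 + (of_real (ln (2 * pi)) + ln_exp_quot z) / 2 + F"
    proof -
      have "(\<Sum>r=1..k-1. c r z M) = F"
        unfolding F_def using k by (intro sum.cong) (auto simp: c_def)
      then show ?thesis
        unfolding split using k by (simp add: c_def[of k] add_divide_distrib)
    qed
    have Li: "(\<Sum>r=1..k. of_nat M / z * (Li2 (\<rho> ^ r * exp z) - Li2 (\<rho> ^ r))) = of_nat N / of_nat k * pfun (of_nat k * z)"
    proof -
      have "(\<Sum>r=1..k. Li2 (\<rho> ^ r * exp z)) = Li2 (exp z ^ k) / of_nat k"
        using Rez by (intro Li2_multisection \<rho> k) simp
      moreover have "(\<Sum>r=1..k. Li2 (\<rho> ^ r)) = Li2 1 / of_nat k"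
        using Li2_multisection[OF \<rho> k, of 1] by simp
      ultimately have "(\<Sum>r=1..k. of_nat M / z * (Li2 (\<rho> ^ r * exp z) - Li2 (\<rho> ^ r)))
         = of_nat M / z * (Li2 (exp z ^ k) / of_nat k - Li2 1 / of_nat k)"
        by (simp only: sum_distrib_left[symmetric] sum_subtractf)
      also have "\<dots> = of_nat N / of_nat k * pfun (of_nat k * z)"
        unfolding pfun_def NM exp_of_nat_mult using k Rez by (simp add: field_simps)
      finally show ?thesis .
    qed
    have f: "(\<Sum>r=1..k. \<Sum>n=2..L. (z / of_nat M) ^ (n - 1) / fact n * d r n z)
       = (\<Sum>l=1..L-1. ffun k \<rho> l z / of_nat N ^ l)"
    proof -
      have "(\<Sum>r=1..k. \<Sum>n=2..L. (z / of_nat M) ^ (n - 1) / fact n * d r n z)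
         = (\<Sum>n=2..L. (z / of_nat M) ^ (n - 1) / fact n * (\<Sum>r=1..k. d r n z))"
        by (subst sum.swap) (simp only: sum_distrib_left)
      also have "\<dots> = (\<Sum>l=1..L-1. (z / of_nat M) ^ l / fact (l + 1) * (\<Sum>r=1..k. d r (l + 1) z))"
        by (rule sum.reindex_bij_witness[where i = "\<lambda>l. l + 1" and j = "\<lambda>n. n - 1"]) auto
      also have "\<dots> = (\<Sum>l=1..L-1. ffun k \<rho> l z / of_nat N ^ l)"
      proof (rule sum.cong[OF refl])
        fix l assume "l \<in> {1..L-1}"
        then have l: "l \<ge> 1" by simp
        have l2: "l + 1 - 2 = l - 1" "l + 1 = 2 \<longleftrightarrow> l = 1" by auto
        have "(\<Sum>r=1..k-1. d r (l + 1) z) = (\<Sum>r=1..k-1. bernpoly (l + 1) (of_nat r / of_nat k)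
             * (polylog_neg (l - 1) (\<rho> ^ r * exp z) - polylog_neg (l - 1) (\<rho> ^ r)))"
          unfolding d_def l2 using k by (intro sum.cong) auto
        moreover have "d k (l + 1) z = bernpoly (l + 1) 1 * (polylog_neg (l - 1) (exp z) + (if l = 1 then 1/2 else 0))"
          unfolding d_def l2 using k by simp
        moreover have "(\<Sum>r=1..k. d r (l + 1) z) = d k (l + 1) z + (\<Sum>r=1..k-1. d r (l + 1) z)"
          unfolding split using k by simp
        ultimately have "ffun k \<rho> l z = (of_nat k * z) ^ l / fact (l + 1) * (\<Sum>r=1..k. d r (l + 1) z)"
          by (simp only: ffun_reflect[OF \<rho>(1) k l])
        then show "(z / of_nat M) ^ l / fact (l + 1) * (\<Sum>r=1..k. d r (l + 1) z) = ffun k \<rho> l z / of_nat N ^ l"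
          using k by (simp only:) (simp add: NM power_mult_distrib power_divide)
      qed
      finally show ?thesis .
    qed
    have A: "(\<Sum>r=1..k. A r z M) = - (of_nat N / of_nat k * pfun (of_nat k * z))
       + (Ln (of_nat M) / 2 + (of_real (ln (2 * pi)) + ln_exp_quot z) / 2 + F)
       - (\<Sum>l=1..L-1. ffun k \<rho> l z / of_nat N ^ l)"
      unfolding A_def sum_subtractf sum.distrib sum_negf c Li f ..
    have "1 / qpoch_rho \<rho> z N = exp (- (\<Sum>r=1..k. T r z M))"
      unfolding NM qpoch_rho_eq_exp[OF \<rho>(1) k Rez(1) M] T_def by (simp add: exp_minus divide_inverse)
    also have "- (\<Sum>r=1..k. T r z M) = - (\<Sum>r=1..k. A r z M) + E"
      by (simp add: E_def sum_subtractf)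
    also have "\<dots> = - (Ln (of_nat M) / 2) + (- ((of_real (ln (2 * pi)) + ln_exp_quot z) / 2) - F)
       + (of_nat N / of_nat k * pfun (of_nat k * z) + (\<Sum>l=1..L-1. ffun k \<rho> l z / of_nat N ^ l) + E)"
      unfolding A by simp
    also have "exp \<dots> = exp (- (Ln (of_nat M) / 2)) * exp (- ((of_real (ln (2 * pi)) + ln_exp_quot z) / 2) - F)
       * exp (of_nat N / of_nat k * pfun (of_nat k * z) + (\<Sum>l=1..L-1. ffun k \<rho> l z / of_nat N ^ l) + E)"
      by (simp only: exp_add)
    also have "exp (- ((of_real (ln (2 * pi)) + ln_exp_quot z) / 2) - F) = gfun k \<rho> z"
      unfolding F_def by (rule gfun_eq_exp[OF \<rho> k Rez(1), symmetric])
    also have "exp (- (Ln (of_nat M) / 2)) = (of_nat k / of_nat N) powr (1/2)"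
    proof -
      have "(of_nat k / of_nat N :: complex) = inverse (of_nat M)"
        using k by (simp add: NM divide_inverse)
      moreover have "Ln (inverse (of_nat M)) = - Ln (of_nat M)"
        using M by (intro Ln_inverse Re_pos_not_nonpos_Reals) simp
      ultimately show ?thesis
        using M by (simp add: powr_def)
    qed
    finally show "\<exists>E. norm E \<le> (\<Sum>r=1..k. K r) * real k ^ L / real N ^ L \<and>
              1 / qpoch_rho \<rho> z N =
                (of_nat k / of_nat N) powr (1/2) * gfun k \<rho> z
                * exp (of_nat N / of_nat k * pfun (of_nat k * z)
                       + (\<Sum>l=1..L-1. ffun k \<rho> l z / of_nat N ^ l) + E)"
      using E by blast
  qed
qed

theorem theorem4p1:
  fixes k L :: nat and \<delta> C :: real
  assumes "k \<ge> 1" and "L \<ge> 1" and "\<delta> > 0" and "C > 0"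
  shows "\<exists>K. \<forall>\<rho> :: complex. \<forall>N :: nat. \<forall>z :: complex.
           \<rho> ^ k = 1 \<and> (\<forall>m. 0 < m \<and> m < k \<longrightarrow> \<rho> ^ m \<noteq> 1) \<and>
           N \<ge> 1 \<and> k dvd N \<and> Re z \<le> - \<delta> \<and> norm z \<le> C \<longrightarrow>
           (\<exists>E :: complex. norm E \<le> K / real N ^ L \<and>
              1 / qpoch_rho \<rho> z N =
                (of_nat k / of_nat N) powr (1/2) * gfun k \<rho> z
                * exp (of_nat N / of_nat k * pfun (of_nat k * z)
                       + (\<Sum>l=1..L-1. ffun k \<rho> l z / of_nat N ^ l) + E))"
proof -
  \<comment> \<open>The bound so far may depend on \<rho>, but there are only finitely many
    primitive k-th roots of unity.\<close>
  define R where "R = {\<rho> :: complex. \<rho> ^ k = 1 \<and> (\<forall>m. 0 < m \<and> m < k \<longrightarrow> \<rho> ^ m \<noteq> 1)}"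
  have "finite {\<rho> :: complex. \<rho> ^ k = 1}"
    using assms(1) by (rule finite_roots_unity)
  then have fin: "finite R"
    by (rule rev_finite_subset) (auto simp: R_def)
  have "\<forall>\<rho>\<in>R. \<exists>K. \<forall>N z. N \<ge> 1 \<and> k dvd N \<and> Re z \<le> - \<delta> \<and> norm z \<le> C \<longrightarrow>
           (\<exists>E :: complex. norm E \<le> K / real N ^ L \<and>
              1 / qpoch_rho \<rho> z N =
                (of_nat k / of_nat N) powr (1/2) * gfun k \<rho> z
                * exp (of_nat N / of_nat k * pfun (of_nat k * z)
                       + (\<Sum>l=1..L-1. ffun k \<rho> l z / of_nat N ^ l) + E))"
    unfolding R_def using qpoch_rho_expansion_fixed_root[OF _ _ assms] by blast
  from bchoice[OF this] obtain K where K: "\<forall>\<rho>\<in>R. \<forall>N z. N \<ge> 1 \<and> k dvd N \<and> Re z \<le> - \<delta> \<and> norm z \<le> C \<longrightarrow>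
           (\<exists>E :: complex. norm E \<le> K \<rho> / real N ^ L \<and>
              1 / qpoch_rho \<rho> z N =
                (of_nat k / of_nat N) powr (1/2) * gfun k \<rho> z
                * exp (of_nat N / of_nat k * pfun (of_nat k * z)
                       + (\<Sum>l=1..L-1. ffun k \<rho> l z / of_nat N ^ l) + E))"
    by blast
  show ?thesis
  \<comment> \<open>A sum serves as a common upper bound; absolute values are taken because the
    individual constants are not known to be nonnegative.\<close>
  proof (intro exI[of _ "\<Sum>\<rho>\<in>R. \<bar>K \<rho>\<bar>"] allI impI, elim conjE)
    fix \<rho> :: complex and N :: nat and z :: complex
    assume "\<rho> ^ k = 1" "\<forall>m. 0 < m \<and> m < k \<longrightarrow> \<rho> ^ m \<noteq> 1"
    then have \<rho>: "\<rho> \<in> R" by (simp add: R_def)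
    assume "N \<ge> 1" "k dvd N" "Re z \<le> - \<delta>" "norm z \<le> C"
    with K \<rho> obtain E where E: "norm E \<le> K \<rho> / real N ^ L"
      "1 / qpoch_rho \<rho> z N =
                (of_nat k / of_nat N) powr (1/2) * gfun k \<rho> z
                * exp (of_nat N / of_nat k * pfun (of_nat k * z)
                       + (\<Sum>l=1..L-1. ffun k \<rho> l z / of_nat N ^ l) + E)"
      by blast
    have "\<bar>K \<rho>\<bar> \<le> (\<Sum>\<rho>\<in>R. \<bar>K \<rho>\<bar>)"
      using \<rho> fin by (intro member_le_sum) auto
    then have "K \<rho> / real N ^ L \<le> (\<Sum>\<rho>\<in>R. \<bar>K \<rho>\<bar>) / real N ^ L"
      by (intro divide_right_mono) auto
    with E show "\<exists>E. norm E \<le> (\<Sum>\<rho>\<in>R. \<bar>K \<rho>\<bar>) / real N ^ L \<and>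
              1 / qpoch_rho \<rho> z N =
                (of_nat k / of_nat N) powr (1/2) * gfun k \<rho> z
                * exp (of_nat N / of_nat k * pfun (of_nat k * z)
                       + (\<Sum>l=1..L-1. ffun k \<rho> l z / of_nat N ^ l) + E)"
      using order_trans by blast
  qed
qed

end
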